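(* Let $u=-K^*x$ be the optimal state-feedback controller for the problem of minimizing $\int_0^\infty(y^\top Qy+u^\top Ru)\,dt$ subject to $\dot x=Ax+Bu$, $y=Cx$, $x(0)=x_0$. Suppose that $M\in\mathbb R^{n\times n}$ is Hurwitz with distinct real eigenvalues. Then the augmented problem of minimizing $\int_0^\infty(y_\zeta^\top Qy_\zeta+u^\top Ru)\,dt$ subject to $$\dot\zeta=\begin{bmatrix}A_\xi&L_zCT^{-1}\Gamma\\0_{n\times n_z}&\Lambda_M\end{bmatrix}\zeta+\begin{bmatrix}B_\xi\\0_{n\times m}\end{bmatrix}u,\quad \zeta(0)=\begin{bmatrix}0_{n_z}\\1_n\end{bmatrix},\quad y_\zeta=[\,C_\xi\ \ CT^{-1}\Gamma\,]\zeta,\qquad \zeta=\begin{bmatrix}z\\\varepsilon\end{bmatrix},$$ with $z\in\mathbb R^{n_z}$, $\varepsilon\in\mathbb R^n$, admits an optimal controller of the form $u=-K_z^*z-K_\varepsilon^*\varepsilon$ in which the gain satisfies $K_z^*=K^*(\theta^\top\otimes T^{-1})$.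
   Context: Setting: $x\in\mathbb R^n$, $u\in\mathbb R^m$, $y\in\mathbb R^p$; $A,B,C$ are constant real matrices, $(A,B)$ controllable, $(C,A)$ observable; $Q$ is a symmetric positive semidefinite $p\times p$ matrix and $R$ a symmetric positive definite $m\times m$ matrix, with $(\sqrt QC,A)$ observable. $K^*=R^{-1}B^\top P^*$, with $P^*$ the unique positive definite solution of $A^\top P+PA-PBR^{-1}B^\top P+C^\top QC=0$. $\mathrm{vec}$ stacks columns, $\otimes$ is the Kronecker product, $1_n$ is the all-ones vector. Filter: $\tilde n_z=(p+m)n$, $n_z=n^2(p+m)$, $Z\in\mathbb R^{n\times\tilde n_z}$, $\dot Z=MZ+[\,y^\top\otimes I_n\ \ u^\top\otimes I_n\,]$. $T\in\mathbb R^{n\times n}$ (nonsingular) and $\theta\in\mathbb R^{\tilde n_z}$ are a fixed pair, depending only on the plant and $M$, such that $Tx(t)=Z(t)\theta+e^{Mt}(Tx_0-Z(0)\theta)$ for all $t\ge0$, all inputs and all initial conditions $x_0,Z(0)$ (such a pair is known to exist when $M$ is Hurwitz with distinct eigenvalues). Further, $$A_z=I_{\tilde n_z}\otimes M,\quad B_\xi=\begin{bmatrix}0_{pn^2\times m}\\ I_m\otimes\mathrm{vec}(I_n)\end{bmatrix},\quad L_z=\begin{bmatrix}I_p\otimes\mathrm{vec}(I_n)\\0_{mn^2\times p}\end{bmatrix},\quad C_\xi=C(\theta^\top\otimes T^{-1}),\quad A_\xi=A_z+L_zC_\xi.$$ $\Lambda_M=\mathrm{diag}(\lambda_1^M,\dots,\lambda_n^M)$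 with $\lambda_i^M$ the eigenvalues of $M$, and $\Gamma\in\mathbb R^{n\times n}$ is a constant matrix with $e^{Mt}Tx_0=\Gamma e^{\Lambda_Mt}1_n$ for all $t\ge0$. *)

theory Defs
  imports "HOL-Analysis.Analysis"
begin

section \<open>Matrices\<close>

definition pos_semidef :: "real^'n^'n \<Rightarrow> bool" where
  "pos_semidef S \<longleftrightarrow> transpose S = S \<and> (\<forall>x. 0 \<le> x \<bullet> (S *v x))"

definition pos_def :: "real^'n^'n \<Rightarrow> bool" where
  "pos_def S \<longleftrightarrow> transpose S = S \<and> (\<forall>x. x \<noteq> 0 \<longrightarrow> 0 < x \<bullet> (S *v x))"

definition eigval :: "'a::field^'n^'n \<Rightarrow> 'a \<Rightarrow> bool" where
  "eigval M c \<longleftrightarrow> (\<exists>v. v \<noteq> 0 \<and> M *v v = c *s v)"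

definition hurwitz :: "real^'n^'n \<Rightarrow> bool" where
  "hurwitz M \<longleftrightarrow> (\<forall>c. eigval (\<chi> i j. complex_of_real (M $ i $ j)) c \<longrightarrow> Re c < 0)"

definition diag :: "real^'n \<Rightarrow> real^'n^'n" where
  "diag d = (\<chi> i j. if i = j then d $ i else 0)"

text \<open>The library's power and \<open>exp\<close> on \<open>real^'n^'n\<close> are not available for the
  matrix product (multiplication of vectors is componentwise), so the matrix exponential
  is given by its power series.\<close>

definition mpow :: "real^'n^'n \<Rightarrow> nat \<Rightarrow> real^'n^'n" where
  "mpow A k = (((**) A) ^^ k) (mat 1)"

definition mexp :: "real^'n^'n \<Rightarrow> real^'n^'n" where
  "mexp A = (\<Sum>k. mpow A k /\<^sub>R fact k)"


section \<open>Block matrices, Kronecker products, vectorization\<close>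

text \<open>A block index set is a sum type. \<open>vcat\<close> stacks both vectors and (since a matrix is a
  vector of rows) matrices.\<close>

definition vcat :: "'x^'a \<Rightarrow> 'x^'b \<Rightarrow> 'x^('a + 'b)" where
  "vcat U V = (\<chi> i. case i of Inl a \<Rightarrow> U $ a | Inr b \<Rightarrow> V $ b)"

definition hcat :: "'x^'a^'r \<Rightarrow> 'x^'b^'r \<Rightarrow> 'x^('a + 'b)^'r" where
  "hcat U V = (\<chi> i. vcat (U $ i) (V $ i))"

definition upper :: "'x^('a::finite + 'b::finite) \<Rightarrow> 'x^'a" where
  "upper v = (\<chi> a. v $ Inl a)"

definition lower :: "'x^('a::finite + 'b::finite) \<Rightarrow> 'x^'b" where
  "lower v = (\<chi> b. v $ Inr b)"

text \<open>The index \<open>(i, k)\<close> stands for position \<open>k\<close> inside block \<open>i\<close>.\<close>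

definition kron :: "real^'b^'a \<Rightarrow> real^'d^'c \<Rightarrow> real^('b \<times> 'd)^('a \<times> 'c)" where
  "kron U V = (\<chi> r s. U $ fst r $ fst s * V $ snd r $ snd s)"

text \<open>\<open>v\<^sup>T \<otimes> V\<close> and \<open>U \<otimes> w\<close> for vectors \<open>v\<close>, \<open>w\<close>: the trivial index of the one-row,
  respectively one-column, factor is dropped.\<close>

definition row_kron :: "real^'b \<Rightarrow> real^'d^'c \<Rightarrow> real^('b \<times> 'd)^'c" where
  "row_kron v V = (\<chi> i. kron (rowvector v :: real^'b^1) V $ (1, i))"

definition kron_col :: "real^'b^'a \<Rightarrow> real^'c \<Rightarrow> real^'b^('a \<times> 'c)" where
  "kron_col U w = (\<chi> r j. kron U (columnvector w :: real^1^'c) $ r $ (j, 1))"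

text \<open>Column stacking: block \<open>j\<close> of the result is column \<open>j\<close> of the matrix.\<close>

definition vec_of_mat :: "'x^'c^'r \<Rightarrow> 'x^('c \<times> 'r)" where
  "vec_of_mat Z = (\<chi> q. Z $ snd q $ fst q)"


section \<open>Linear systems and the linear-quadratic problem\<close>

text \<open>Inputs are locally (Lebesgue) integrable on \<open>[0,\<infinity>)\<close>, and \<open>x\<close> is the Caratheodory
  solution of \<open>x' = A x + B u\<close>, \<open>x(0) = x0\<close>.\<close>

definition trajectory ::
  "real^'n^'n \<Rightarrow> real^'m^'n \<Rightarrow> real^'n \<Rightarrow> (real \<Rightarrow> real^'m) \<Rightarrow> (real \<Rightarrow> real^'n) \<Rightarrow> bool" where
  "trajectory A B x0 u x \<longleftrightarrow>
     (\<forall>t\<ge>0. u absolutely_integrable_on {0..t}) \<and>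
     (\<forall>t\<ge>0. ((\<lambda>s. A *v x s + B *v u s) has_integral (x t - x0)) {0..t})"

definition controllable :: "real^'n^'n \<Rightarrow> real^'m^'n \<Rightarrow> bool" where
  "controllable A B \<longleftrightarrow> (\<forall>x0 x1. \<exists>t>0. \<exists>u x. trajectory A B x0 u x \<and> x t = x1)"

text \<open>The output of \<open>x' = A x\<close>, \<open>y = C x\<close> over some finite time interval determines the
  initial state.\<close>

definition observable :: "real^'n^'p \<Rightarrow> real^'n^'n \<Rightarrow> bool" where
  "observable C A \<longleftrightarrow>
     (\<exists>t1>0. \<forall>x0 x1. (\<forall>t\<in>{0..t1}. C *v (mexp (t *\<^sub>R A) *v x0) = C *v (mexp (t *\<^sub>R A) *v x1))
        \<longrightarrow> x0 = x1)"

definition lq_cost ::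
  "real^'n^'p \<Rightarrow> real^'p^'p \<Rightarrow> real^'m^'m \<Rightarrow> (real \<Rightarrow> real^'m) \<Rightarrow> (real \<Rightarrow> real^'n) \<Rightarrow> ennreal" where
  "lq_cost C Q R u x =
     (\<integral>\<^sup>+ t\<in>{0..}. ennreal ((C *v x t) \<bullet> (Q *v (C *v x t)) + u t \<bullet> (R *v u t)) \<partial>lebesgue)"

text \<open>The feedback law \<open>u = \<kappa>(x)\<close> is optimal for the problem with initial state \<open>x0\<close>: the closed
  loop has a solution, and the cost along it is finite and minimal among all inputs.\<close>

definition optimal_controller ::
  "real^'n^'n \<Rightarrow> real^'m^'n \<Rightarrow> real^'n^'p \<Rightarrow> real^'p^'p \<Rightarrow> real^'m^'m \<Rightarrow> real^'n
     \<Rightarrow> (real^'n \<Rightarrow> real^'m) \<Rightarrow> bool" where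
  "optimal_controller A B C Q R x0 \<kappa> \<longleftrightarrow>
     (\<exists>x. trajectory A B x0 (\<lambda>t. \<kappa> (x t)) x) \<and>
     (\<forall>x. trajectory A B x0 (\<lambda>t. \<kappa> (x t)) x \<longrightarrow>
        lq_cost C Q R (\<lambda>t. \<kappa> (x t)) x < \<infinity> \<and>
        (\<forall>u' x'. trajectory A B x0 u' x' \<longrightarrow>
           lq_cost C Q R (\<lambda>t. \<kappa> (x t)) x \<le> lq_cost C Q R u' x'))"


section \<open>The filter and its vectorized realization\<close>

text \<open>Index set of the columns of \<open>Z\<close>; it has \<open>(p + m) n\<close> elements.\<close>

type_synonym ('p, 'm, 'n) zcol = "('p \<times> 'n) + ('m \<times> 'n)"

definition regressor :: "real^'p \<Rightarrow> real^'m \<Rightarrow> real^('p, 'm, 'n) zcol^'n" where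
  "regressor y u = hcat (row_kron y (mat 1)) (row_kron u (mat 1))"

text \<open>\<open>Z\<close> solves \<open>Z' = M Z + [y\<^sup>T \<otimes> I  u\<^sup>T \<otimes> I]\<close>; the initial value \<open>Z 0\<close> is free.\<close>

definition filter_trajectory ::
  "real^'n^'n \<Rightarrow> (real \<Rightarrow> real^'p) \<Rightarrow> (real \<Rightarrow> real^'m) \<Rightarrow>
     (real \<Rightarrow> real^('p, 'm, 'n) zcol^'n) \<Rightarrow> bool" where
  "filter_trajectory M y u Z \<longleftrightarrow>
     (\<forall>t\<ge>0. ((\<lambda>s. M ** Z s + regressor (y s) (u s)) has_integral (Z t - Z 0)) {0..t})"

text \<open>The pair \<open>(T, \<theta>)\<close> parametrizes the plant state by the filter state.\<close>

definition filter_parametrization ::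
  "real^'n^'n \<Rightarrow> real^'m^'n \<Rightarrow> real^'n^'p \<Rightarrow> real^'n^'n \<Rightarrow> real^'n^'n
     \<Rightarrow> real^('p, 'm, 'n) zcol \<Rightarrow> bool" where
  "filter_parametrization A B C M T \<theta> \<longleftrightarrow>
     (\<forall>u x Z. trajectory A B (x 0) u x \<and> filter_trajectory M (\<lambda>t. C *v x t) u Z \<longrightarrow>
        (\<forall>t\<ge>0. T *v x t = Z t *v \<theta> + mexp (t *\<^sub>R M) *v (T *v x 0 - Z 0 *v \<theta>)))"

text \<open>The rows of \<open>I\<^sub>p \<otimes> vec I\<^sub>n\<close> and \<open>I\<^sub>m \<otimes> vec I\<^sub>n\<close>, stacked, are indexed by
  \<open>p \<times> (n \<times> n) + m \<times> (n \<times> n)\<close>, the entries of \<open>vec Z\<close> by \<open>(p \<times> n + m \<times> n) \<times> n\<close>.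
  \<open>regroup\<close> is the identification of the two index sets; it keeps the order of the rows.\<close>

definition regroup ::
  "'x^(('p::finite \<times> ('n::finite \<times> 'n)) + ('m::finite \<times> ('n \<times> 'n))) \<Rightarrow> 'x^(('p, 'm, 'n) zcol \<times> 'n)" where
  "regroup W = (\<chi> q. case fst q of Inl (a, j) \<Rightarrow> W $ Inl (a, (j, snd q))
                                | Inr (a, j) \<Rightarrow> W $ Inr (a, (j, snd q)))"

definition A_z :: "real^'n^'n \<Rightarrow> real^(('p::finite, 'm::finite, 'n) zcol \<times> 'n)^(('p, 'm, 'n) zcol \<times> 'n)" where
  "A_z M = kron (mat 1) M"

definition B_xi :: "real^'m^(('p::finite, 'm, 'n::finite) zcol \<times> 'n)" where
  "B_xi = regroup (vcat 0 (kron_col (mat 1) (vec_of_mat (mat 1 :: real^'n^'n))))"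

definition L_z :: "real^'p^(('p, 'm::finite, 'n::finite) zcol \<times> 'n)" where
  "L_z = regroup (vcat (kron_col (mat 1) (vec_of_mat (mat 1 :: real^'n^'n))) 0)"

definition C_xi ::
  "real^'n^'p \<Rightarrow> real^('p, 'm::finite, 'n) zcol \<Rightarrow> real^'n^'n \<Rightarrow> real^(('p, 'm, 'n) zcol \<times> 'n)^'p" where
  "C_xi C \<theta> T = C ** row_kron \<theta> (matrix_inv T)"

definition A_xi ::
  "real^'n^'n \<Rightarrow> real^'n^'p \<Rightarrow> real^('p, 'm::finite, 'n) zcol \<Rightarrow> real^'n^'n
     \<Rightarrow> real^(('p, 'm, 'n) zcol \<times> 'n)^(('p, 'm, 'n) zcol \<times> 'n)" where
  "A_xi M C \<theta> T = A_z M + L_z ** C_xi C \<theta> T"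

text \<open>These confirm the index conventions: for \<open>z = vec Z\<close> the filter equation reads
  \<open>z' = A\<^sub>z z + L\<^sub>z y + B\<^sub>\<xi> u\<close>, and \<open>(\<theta>\<^sup>T \<otimes> V) z = V Z \<theta>\<close>.\<close>

lemma vec_of_mat_regressor:
  "vec_of_mat (regressor y u :: real^('p::finite, 'm::finite, 'n::finite) zcol^'n) = L_z *v y + B_xi *v u"
  apply (simp add: vec_eq_iff split_paired_all)
  apply (auto simp: vec_of_mat_def regressor_def L_z_def B_xi_def regroup_def hcat_def vcat_def kron_col_def row_kron_def kron_def rowvector_def columnvector_def matrix_vector_mult_def mat_def if_distrib[of "\<lambda>x. x * _"] if_distrib[of "\<lambda>x. _ * x"] sum.If_cases split: sum.splits prod.splits)
  done

lemma row_kron_vec_of_mat: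
  "row_kron \<theta> (V :: real^'n^'n) *v vec_of_mat Z = V *v (Z *v \<theta>)"
  apply (simp add: vec_eq_iff vec_of_mat_def row_kron_def kron_def rowvector_def matrix_vector_mult_def sum_distrib_left sum_distrib_right UNIV_Times_UNIV[symmetric] sum.cartesian_product' del: UNIV_Times_UNIV)
  apply (subst sum.swap)
  apply (simp add: algebra_simps)
  done

lemma vec_of_mat_mult:
  "vec_of_mat (M ** Z) = (A_z M :: real^(('p::finite, 'm::finite, 'n::finite) zcol \<times> 'n)^(('p, 'm, 'n) zcol \<times> 'n)) *v vec_of_mat Z"
  apply (simp add: vec_eq_iff vec_of_mat_def A_z_def kron_def mat_def matrix_vector_mult_def matrix_matrix_mult_def sum_distrib_left sum_distrib_right UNIV_Times_UNIV[symmetric] sum.cartesian_product' del: UNIV_Times_UNIV)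
  apply (subst sum.swap)
  apply (simp add: if_distrib[of "\<lambda>x. x * _"] if_distrib[of "\<lambda>x. _ * x"] cong: if_cong)
  done

end

theory Submission
  imports Defs
begin

text \<open>
  The augmented problem is the original one in other coordinates. The plant state can be read off the
  augmented state as \<open>x = (\<theta>\<^sup>T \<otimes> inverse T) z + inverse T \<Gamma> \<epsilon>\<close>. Along every augmented trajectory
  this \<open>x\<close> is the plant trajectory from \<open>x0\<close> with the same input
  (\<open>augmented_trajectory_yields_plant_trajectory\<close>), and the augmented output is \<open>C x\<close>. So both problems
  assign the same cost to an input, and the optimal feedback \<open>u = - K x\<close> of the plant, rewritten in terms of
  \<open>z\<close> and \<open>\<epsilon>\<close>, is optimal for the augmented problem. The coefficient of \<open>z\<close> is
  \<open>K (\<theta>\<^sup>T \<otimes> inverse T)\<close>, and that of \<open>\<epsilon>\<close> is \<open>K inverse T \<Gamma>\<close>.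

  The embedding into the plant rests on an algebraic form of the filter parametrization
  (\<open>plant_identity_of_filter_parametrization\<close>), obtained by differentiation at time 0, and on
  \<open>\<Gamma> \<epsilon> = exp (M t) T x0\<close>, whose derivative shows that \<open>\<Gamma> \<epsilon>\<close> evolves by \<open>M\<close>.

  What remains is the optimality of \<open>u = - K x\<close> for the plant, for inputs that are only locally integrable.
  Completion of the square with the Riccati equation (\<open>riccati_cost_identity\<close>) bounds the closed-loop cost
  by \<open>x0 \<bullet> P x0\<close>, and bounds the cost of any input over a finite horizon below by
  \<open>x0 \<bullet> P x0 - x t \<bullet> P (x t)\<close>. The last term is made small by observability of the weighted
  output: an inequality for the discounted observability Gramian (\<open>observability_inequality\<close>) shows that the
  state of a finite-cost trajectory cannot stay away from zero (\<open>riccati_cost_ge\<close>). All calculus along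
  trajectories uses a product rule for indefinite integrals (\<open>has_integral_product_rule\<close>).
\<close>


section \<open>Calculus for indefinite integrals\<close>

text \<open>An elementary substitute for "absolutely continuous with derivative zero almost everywhere implies
  constant": on a fine partition the increments of \<open>H\<close> add up to at most \<open>\<epsilon>\<close> times
  the total increment of \<open>\<mu>\<close>.\<close>

lemma eq_if_increments_dominated:
  fixes H :: "real \<Rightarrow> 'a::real_normed_vector" and \<mu> :: "real \<Rightarrow> real"
  assumes "a \<le> b"
    and dom: "\<And>\<epsilon>. 0 < \<epsilon> \<Longrightarrow>
      \<exists>\<delta>>0. \<forall>s t. a \<le> s \<and> s \<le> t \<and> t \<le> b \<and> t - s < \<delta> \<longrightarrow> norm (H t - H s) \<le> \<epsilon> * (\<mu> t - \<mu> s)"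
  shows "H b = H a"
proof -
  have bound: "norm (H b - H a) \<le> \<epsilon> * (\<mu> b - \<mu> a)" if "0 < \<epsilon>" for \<epsilon>
  proof -
    obtain \<delta> where \<delta>: "0 < \<delta>"
      "\<And>s t. a \<le> s \<Longrightarrow> s \<le> t \<Longrightarrow> t \<le> b \<Longrightarrow> t - s < \<delta> \<Longrightarrow> norm (H t - H s) \<le> \<epsilon> * (\<mu> t - \<mu> s)"
      using dom[OF \<open>0 < \<epsilon>\<close>] by blast
    obtain n :: nat where n: "(b - a) / \<delta> < real n" using reals_Archimedean2 by blast
    then have "0 < real n"
      using \<open>a \<le> b\<close> \<delta>(1) by (meson diff_ge_0_iff_ge divide_nonneg_pos le_less_trans)
    define p where "p k = a + real k * ((b - a) / n)" for k
    have step: "0 \<le> (b - a) / n" "(b - a) / n < \<delta>"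
      using n \<open>0 < real n\<close> \<delta>(1) \<open>a \<le> b\<close> by (simp_all add: field_simps)
    have "norm (H (p k) - H a) \<le> \<epsilon> * (\<mu> (p k) - \<mu> a)" if "k \<le> n" for k
      using that
    proof (induction k)
      case 0 then show ?case by (simp add: p_def)
    next
      case (Suc k)
      have "real (Suc k) * ((b - a) / n) \<le> real n * ((b - a) / n)"
        using Suc.prems step(1) by (intro mult_right_mono) auto
      then have "p (Suc k) \<le> b" using \<open>0 < real n\<close> by (simp add: p_def)
      moreover have "p (Suc k) - p k = (b - a) / n"
        unfolding p_def by (simp add: distrib_right add_divide_distrib)
      ultimately have "norm (H (p (Suc k)) - H (p k)) \<le> \<epsilon> * (\<mu> (p (Suc k)) - \<mu> (p k))"
        using step \<open>a \<le> b\<close> by (intro \<delta>(2)) (simp_all add: p_def divide_right_mono mult_right_mono)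
      moreover have "norm (H (p (Suc k)) - H a) \<le> norm (H (p (Suc k)) - H (p k)) + norm (H (p k) - H a)"
        by (metis diff_add_cancel add_diff_eq norm_triangle_ineq)
      ultimately show ?case using Suc by (simp add: right_diff_distrib)
    qed
    from this[of n] show ?thesis using \<open>0 < real n\<close> by (simp add: p_def)
  qed
  have "norm (H b - H a) \<le> e" if "0 < e" for e
  proof -
    \<comment> \<open>The summand 1 keeps the divisor positive when \<open>\<mu>\<close> does not grow.\<close>
    let ?m = "\<bar>\<mu> b - \<mu> a\<bar> + 1"
    have "norm (H b - H a) \<le> e / ?m * (\<mu> b - \<mu> a)" by (rule bound) (use that in simp)
    also have "\<dots> \<le> e / ?m * ?m" using that by (intro mult_left_mono) auto
    finally show ?thesis by simp
  qed
  then have "norm (H b - H a) \<le> 0" by (metis dense_ge)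
  then show ?thesis by simp
qed

lemma continuous_on_if_has_integral:
  fixes f :: "real \<Rightarrow> 'a::euclidean_space"
  assumes "\<And>t. t \<in> {a..b} \<Longrightarrow> (f has_integral F t - F a) {a..t}"
  shows "continuous_on {a..b} F"
proof (cases "a \<le> b")
  case True
  have "f integrable_on {a..b}" using assms[of b] True by auto
  then have "continuous_on {a..b} (\<lambda>t. F a + integral {a..t} f)"
    by (intro continuous_intros indefinite_integral_continuous_1)
  moreover have "F a + integral {a..t} f = F t" if "t \<in> {a..b}" for t
    using assms[OF that] by (simp add: integral_unique)
  ultimately show ?thesis using continuous_on_eq by blast
qed simp

lemma absolutely_integrable_bilinear_continuous:
  fixes F :: "real \<Rightarrow> 'a::euclidean_space" and g :: "real \<Rightarrow> 'b::euclidean_space"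
    and mul :: "'a \<Rightarrow> 'b \<Rightarrow> 'c::euclidean_space"
  assumes "bounded_bilinear mul" "continuous_on {a..b} F" "g absolutely_integrable_on {a..b}"
  shows "(\<lambda>t. mul (F t) (g t)) absolutely_integrable_on {a..b}"
proof (rule absolutely_integrable_bounded_measurable_product[where h = mul])
  show "F \<in> borel_measurable (lebesgue_on {a..b})"
    using assms(2) by (rule continuous_imp_measurable_on_sets_lebesgue) auto
  show "bounded (F ` {a..b})"
    using assms(2) by (intro compact_imp_bounded compact_continuous_image) auto
qed (use assms in \<open>auto simp: bilinear_conv_bounded_bilinear\<close>)

text \<open>Trajectories driven by integrable inputs are differentiable only almost everywhere, so the
  product rule is needed for indefinite integrals. The defect
  \<open>H t = mul (F t) (G t) - \<integral>(mul f G + mul F g)\<close> has increments over \<open>[s, t]\<close> equal to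
  \<open>\<integral> mul (f r) (G t - G r) + mul (F s - F r) (g r)\<close>, and on short intervals the
  differences of \<open>F\<close> and \<open>G\<close> are uniformly small. Hence \<open>H\<close> is constant.\<close>

lemma has_integral_product_rule:
  fixes F f :: "real \<Rightarrow> 'a::euclidean_space" and G g :: "real \<Rightarrow> 'b::euclidean_space"
    and mul :: "'a \<Rightarrow> 'b \<Rightarrow> 'c::euclidean_space"
  assumes mul: "bounded_bilinear mul" and "a \<le> b"
    and f: "f absolutely_integrable_on {a..b}" and g: "g absolutely_integrable_on {a..b}"
    and F: "\<And>t. t \<in> {a..b} \<Longrightarrow> (f has_integral F t - F a) {a..t}"
    and G: "\<And>t. t \<in> {a..b} \<Longrightarrow> (g has_integral G t - G a) {a..t}"
  shows "((\<lambda>t. mul (f t) (G t) + mul (F t) (g t)) has_integral mul (F b) (G b) - mul (F a) (G a)) {a..b}"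
    and "(\<lambda>t. mul (f t) (G t) + mul (F t) (g t)) absolutely_integrable_on {a..b}"
proof -
  interpret bounded_bilinear mul by (rule mul)
  note contF = continuous_on_if_has_integral[OF F] and contG = continuous_on_if_has_integral[OF G]
  define h where "h t = mul (f t) (G t) + mul (F t) (g t)" for t
  define H where "H t = mul (F t) (G t) - integral {a..t} h" for t
  define \<mu> where "\<mu> t = integral {a..t} (\<lambda>r. norm (f r) + norm (g r))" for t
  have int: "f integrable_on {s..t}" "g integrable_on {s..t}"
    "(\<lambda>r. norm (f r)) integrable_on {s..t}" "(\<lambda>r. norm (g r)) integrable_on {s..t}"
    if "a \<le> s" "t \<le> b" for s t
    using that f g unfolding absolutely_integrable_on_def
    by (auto intro: integrable_on_subinterval[of _ "{a..b}"])
  show h_abs: "(\<lambda>t. mul (f t) (G t) + mul (F t) (g t)) absolutely_integrable_on {a..b}"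
    using absolutely_integrable_bilinear_continuous[OF flip contG f]
      absolutely_integrable_bilinear_continuous[OF mul contF g]
    by (rule set_integral_add)
  then have h_int: "h integrable_on {s..t}" if "a \<le> s" "t \<le> b" for s t
    using that unfolding h_def absolutely_integrable_on_def
    by (auto intro: integrable_on_subinterval[of _ "{a..b}"])
  have split: "integral {a..t} k - integral {a..s} k = integral {s..t} k"
    if "a \<le> s" "s \<le> t" "t \<le> b" "k integrable_on {a..b}" for k :: "real \<Rightarrow> 'd::euclidean_space" and s t
    using that Henstock_Kurzweil_Integration.integral_combine[of a s t k]
      integrable_on_subinterval[of k "{a..b}" a t] by (simp add: algebra_simps)
  have F_inc: "(f has_integral F t - F s) {s..t}" and G_inc: "(g has_integral G t - G s) {s..t}"
    if "a \<le> s" "s \<le> t" "t \<le> b" for s t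
    using split[OF that int(1)[OF order_refl order_refl]] split[OF that int(2)[OF order_refl order_refl]]
      integral_unique[OF F[of s]] integral_unique[OF F[of t]]
      integral_unique[OF G[of s]] integral_unique[OF G[of t]] that
      integrable_integral[OF int(1)[OF that(1,3)]] integrable_integral[OF int(2)[OF that(1,3)]]
    by simp_all
  obtain K where K: "0 < K" "\<And>x y. norm (mul x y) \<le> norm x * norm y * K"
    using pos_bounded by blast
  have "H b = H a"
  proof (rule eq_if_increments_dominated[OF \<open>a \<le> b\<close>])
    fix \<epsilon> :: real assume "0 < \<epsilon>"
    have "0 < \<epsilon> / K" using \<open>0 < \<epsilon>\<close> K(1) by simp
    have "uniformly_continuous_on {a..b} F" "uniformly_continuous_on {a..b} G"
      using contF contG by (auto intro: compact_uniformly_continuous)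
    from uniformly_continuous_onE[OF this(1) \<open>0 < \<epsilon> / K\<close>] uniformly_continuous_onE[OF this(2) \<open>0 < \<epsilon> / K\<close>]
    obtain d1 d2 where d: "0 < d1" "0 < d2"
      "\<And>x y. x \<in> {a..b} \<Longrightarrow> y \<in> {a..b} \<Longrightarrow> dist y x < d1 \<Longrightarrow> dist (F y) (F x) < \<epsilon> / K"
      "\<And>x y. x \<in> {a..b} \<Longrightarrow> y \<in> {a..b} \<Longrightarrow> dist y x < d2 \<Longrightarrow> dist (G y) (G x) < \<epsilon> / K"
      by metis
    show "\<exists>\<delta>>0. \<forall>s t. a \<le> s \<and> s \<le> t \<and> t \<le> b \<and> t - s < \<delta> \<longrightarrow> norm (H t - H s) \<le> \<epsilon> * (\<mu> t - \<mu> s)"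
    proof (intro exI[of _ "min d1 d2"] conjI allI impI)
      fix s t assume st: "a \<le> s \<and> s \<le> t \<and> t \<le> b \<and> t - s < min d1 d2"
      have "((\<lambda>r. mul (f r) (G t) + mul (F s) (g r) - h r) has_integral
          mul (F t - F s) (G t) + mul (F s) (G t - G s) - integral {s..t} h) {s..t}"
        using st by (intro has_integral_add has_integral_diff
            has_integral_linear[OF F_inc bounded_linear_left, unfolded o_def]
            has_integral_linear[OF G_inc bounded_linear_right, unfolded o_def]
            integrable_integral h_int) auto
      moreover have "mul (F t - F s) (G t) + mul (F s) (G t - G s) - integral {s..t} h = H t - H s"
        using split[of s t h] st h_int[OF order_refl order_refl] by (simp add: H_def diff_left diff_right algebra_simps)
      ultimately have inc: "((\<lambda>r. mul (f r) (G t) + mul (F s) (g r) - h r) has_integral H t - H s) {s..t}"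
        by simp
      have "norm (integral {s..t} (\<lambda>r. mul (f r) (G t) + mul (F s) (g r) - h r))
          \<le> integral {s..t} (\<lambda>r. \<epsilon> * (norm (f r) + norm (g r)))"
      proof (rule integral_norm_bound_integral)
        show "(\<lambda>r. mul (f r) (G t) + mul (F s) (g r) - h r) integrable_on {s..t}" using inc by blast
        show "(\<lambda>r. \<epsilon> * (norm (f r) + norm (g r))) integrable_on {s..t}"
          using st by (intro integrable_on_mult_right integrable_add int) auto
        fix r assume r: "r \<in> {s..t}"
        have dFG: "norm (F s - F r) \<le> \<epsilon> / K" "norm (G t - G r) \<le> \<epsilon> / K"
          using d(3)[of r s] d(4)[of r t] r st by (auto simp: dist_norm)
        have "norm (mul (f r) (G t) + mul (F s) (g r) - h r)
            = norm (mul (f r) (G t - G r) + mul (F s - F r) (g r))"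
          by (simp add: h_def diff_left diff_right algebra_simps)
        also have "\<dots> \<le> norm (f r) * norm (G t - G r) * K + norm (F s - F r) * norm (g r) * K"
          by (intro norm_triangle_le add_mono K)
        also have "\<dots> \<le> norm (f r) * (\<epsilon> / K) * K + \<epsilon> / K * norm (g r) * K"
          using dFG K(1) by (intro add_mono mult_right_mono mult_left_mono) auto
        also have "\<dots> = \<epsilon> * (norm (f r) + norm (g r))" using K(1) by (simp add: field_simps)
        finally show "norm (mul (f r) (G t) + mul (F s) (g r) - h r) \<le> \<epsilon> * (norm (f r) + norm (g r))" .
      qed
      also have "\<dots> = \<epsilon> * (\<mu> t - \<mu> s)"
        using split[of s t "\<lambda>r. norm (f r) + norm (g r)"] st int[OF order_refl order_refl]
        by (simp add: \<mu>_def integrable_add)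
      finally show "norm (H t - H s) \<le> \<epsilon> * (\<mu> t - \<mu> s)" using integral_unique[OF inc] by simp
    qed (use d in simp)
  qed
  then have "integral {a..b} h = mul (F b) (G b) - mul (F a) (G a)"
    by (simp add: H_def algebra_simps)
  then show "((\<lambda>t. mul (f t) (G t) + mul (F t) (g t)) has_integral mul (F b) (G b) - mul (F a) (G a)) {a..b}"
    using h_int[OF order_refl order_refl] by (metis (no_types, lifting) h_def has_integral_integral ext)
qed


section \<open>Matrices and quadratic forms\<close>

lemma bounded_bilinear_matrix_matrix_mult:
  "bounded_bilinear ((**) :: real^'n^'m \<Rightarrow> real^'k^'n \<Rightarrow> real^'k^'m)"
  unfolding bilinear_conv_bounded_bilinear[symmetric] bilinear_def
  by (auto intro!: linearI simp: vec_eq_iff matrix_matrix_mult_def sum_distrib_left algebra_simps sum.distrib)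

lemma bounded_bilinear_matrix_vector_mult:
  "bounded_bilinear ((*v) :: real^'n^'m \<Rightarrow> real^'n \<Rightarrow> real^'m)"
  unfolding bilinear_conv_bounded_bilinear[symmetric] bilinear_def
  by (auto intro!: linearI simp: vec_eq_iff matrix_vector_mult_def sum_distrib_left algebra_simps sum.distrib)

interpretation mm: bounded_bilinear "(**) :: real^'n^'m \<Rightarrow> real^'k^'n \<Rightarrow> real^'k^'m"
  by (rule bounded_bilinear_matrix_matrix_mult)

interpretation mv: bounded_bilinear "(*v) :: real^'n^'m \<Rightarrow> real^'n \<Rightarrow> real^'m"
  by (rule bounded_bilinear_matrix_vector_mult)

lemma linear_matrix_mult_left: "linear ((**) (A :: real^'n^'m) :: real^'k^'n \<Rightarrow> _)"
  using mm.bounded_linear_right by (rule bounded_linear.linear)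

lemma bounded_linear_transpose: "bounded_linear (transpose :: real^'n^'m \<Rightarrow> real^'m^'n)"
  by (intro linear_conv_bounded_linear[THEN iffD1] linearI) (auto simp: transpose_def vec_eq_iff)

lemma inner_transpose_right: "x \<bullet> (transpose A *v y) = (A *v x) \<bullet> y" for A :: "real^'n^'m"
  using dot_lmul_matrix[of y A x] by (simp add: inner_commute)

lemma inner_transpose_mult: "x \<bullet> ((transpose D ** D) *v x) = (norm (D *v x))\<^sup>2" for D :: "real^'n^'m"
  by (simp add: matrix_vector_mul_assoc[symmetric] inner_transpose_right dot_square_norm del: transpose_matrix_vector)

text \<open>The constant is the minimum of the form on the unit sphere.\<close>

lemma coercive_if_pos_def_form:
  fixes S :: "real^'n^'n"
  assumes "\<And>x. x \<noteq> 0 \<Longrightarrow> 0 < x \<bullet> (S *v x)"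
  obtains c where "0 < c" "\<And>x. c * (norm x)\<^sup>2 \<le> x \<bullet> (S *v x)"
proof -
  have "continuous_on (sphere 0 1) (\<lambda>x. x \<bullet> (S *v x))"
    by (intro continuous_intros linear_continuous_on) auto
  moreover have "sphere (0 :: real^'n) 1 \<noteq> {}" using vector_choose_size[of 1] by auto
  ultimately obtain y where y: "y \<in> sphere 0 1" "\<And>x. x \<in> sphere 0 1 \<Longrightarrow> y \<bullet> (S *v y) \<le> x \<bullet> (S *v x)"
    using continuous_attains_inf[of "sphere 0 1" "\<lambda>x. x \<bullet> (S *v x)"] by auto
  show thesis
  proof (rule that)
    show "0 < y \<bullet> (S *v y)" using y(1) by (intro assms) auto
    fix x :: "real^'n"
    show "y \<bullet> (S *v y) * (norm x)\<^sup>2 \<le> x \<bullet> (S *v x)"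
    proof (cases "x = 0")
      case False
      then have "y \<bullet> (S *v y) \<le> (x /\<^sub>R norm x) \<bullet> (S *v (x /\<^sub>R norm x))" by (intro y(2)) auto
      also have "\<dots> = (x \<bullet> (S *v x)) / (norm x)\<^sup>2"
        by (simp add: matrix_vector_mult_scaleR power2_eq_square divide_inverse)
      finally show ?thesis using False by (simp add: pos_le_divide_eq)
    qed simp
  qed
qed

lemma quadratic_form_le:
  fixes S :: "real^'n^'n"
  obtains c where "0 < c" "\<And>x. x \<bullet> (S *v x) \<le> c * (norm x)\<^sup>2"
proof -
  obtain K where K: "0 < K" "\<And>x. norm (S *v x) \<le> norm x * K"
    using bounded_linear.pos_bounded[OF mv.bounded_linear_right[of S]] by blast
  have "x \<bullet> (S *v x) \<le> K * (norm x)\<^sup>2" for x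
    using order_trans[OF norm_cauchy_schwarz mult_left_mono[OF K(2), of "norm x" x]]
    by (simp add: power2_eq_square mult_ac)
  then show thesis using K(1) that by blast
qed

lemma pos_def_invertible:
  assumes "pos_def R"
  shows "invertible R"
proof -
  have "x = 0" if "R *v x = 0" for x
    using assms that unfolding pos_def_def by (metis inner_zero_right less_irrefl)
  then show ?thesis unfolding invertible_left_inverse matrix_left_invertible_ker by blast
qed

lemma matrix_inv_mult:
  fixes S :: "real^'n^'n"
  assumes "invertible S"
  shows "S ** matrix_inv S = mat 1" and "matrix_inv S ** S = mat 1"
  using assms unfolding invertible_def matrix_inv_def by (metis (mono_tags, lifting) someI_ex)+


section \<open>Linear differential equations and the matrix exponential\<close>

text \<open>The exponential series of a linear map applied to a vector, on any Euclidean space. Its components are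
  scalar power series and may be differentiated term by term. Working on an abstract space lets one lemma
  serve for the matrix exponential (left multiplication on matrices) and for coupled systems on
  product spaces.\<close>

lemma linear_ode_has_solution:
  fixes f :: "'a::euclidean_space \<Rightarrow> 'a"
  assumes "linear f"
  shows "summable (\<lambda>k. (t ^ k / fact k) *\<^sub>R (f ^^ k) w)"
    and "((\<lambda>t. \<Sum>k. (t ^ k / fact k) *\<^sub>R (f ^^ k) w) has_vector_derivative
           f (\<Sum>k. (t ^ k / fact k) *\<^sub>R (f ^^ k) w)) (at t)"
proof -
  interpret f: bounded_linear f using assms by (simp add: linear_conv_bounded_linear)
  obtain K where K: "0 < K" "\<And>x. norm (f x) \<le> norm x * K" using f.pos_bounded by blast
  have bound: "norm ((f ^^ k) w) \<le> K ^ k * norm w" for k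
  proof (induction k)
    case (Suc k)
    have "norm ((f ^^ Suc k) w) \<le> norm ((f ^^ k) w) * K" using K(2) by simp
    also have "\<dots> \<le> K ^ k * norm w * K" using Suc K(1) by (intro mult_right_mono) auto
    finally show ?case by (simp add: mult_ac)
  qed simp
  have summ: "summable (\<lambda>k. (t ^ k / fact k) *\<^sub>R (f ^^ k) w)" for t :: real
  proof (rule summable_comparison_test')
    show "summable (\<lambda>k. norm w * ((K * \<bar>t\<bar>) ^ k / fact k))"
      using summable_exp[of "K * \<bar>t\<bar>"] by (intro summable_mult) (simp add: field_simps)
    show "norm ((t ^ k / fact k) *\<^sub>R (f ^^ k) w) \<le> norm w * ((K * \<bar>t\<bar>) ^ k / fact k)" for k
      using mult_left_mono[OF bound[of k], of "\<bar>t\<bar> ^ k / fact k"]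
      by (simp add: power_abs power_mult_distrib mult_ac)
  qed
  show "summable (\<lambda>k. (t ^ k / fact k) *\<^sub>R (f ^^ k) w)" by (rule summ)
  define e where "e = (\<lambda>t::real. \<Sum>k. (t ^ k / fact k) *\<^sub>R (f ^^ k) w)"
  have comp: "e t \<bullet> b = (\<Sum>k. ((f ^^ k) w \<bullet> b / fact k) * t ^ k)"
    and comp_summ: "summable (\<lambda>k. ((f ^^ k) w \<bullet> b / fact k) * t ^ k)" for t b
    using bounded_linear.suminf[OF bounded_linear_inner_left[of b] summ[of t]]
      bounded_linear.summable[OF bounded_linear_inner_left[of b] summ[of t]]
    by (simp_all add: e_def field_simps)
  have f_e: "f (e t) = (\<Sum>k. (t ^ k / fact k) *\<^sub>R (f ^^ Suc k) w)" for t
    using f.suminf[OF summ] by (simp add: e_def f.scaleR)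
  have f_summ: "summable (\<lambda>k. (t ^ k / fact k) *\<^sub>R (f ^^ Suc k) w)" for t
    using f.summable[OF summ] by (simp add: f.scaleR)
  have "((\<lambda>t. e t \<bullet> b) has_vector_derivative f (e t) \<bullet> b) (at t)" for t b
  proof -
    have "((\<lambda>t. \<Sum>k. ((f ^^ k) w \<bullet> b / fact k) * t ^ k) has_field_derivative
        (\<Sum>k. diffs (\<lambda>k. (f ^^ k) w \<bullet> b / fact k) k * t ^ k)) (at t)"
      by (rule termdiffs_strong_converges_everywhere) (rule comp_summ)
    moreover have "(\<Sum>k. diffs (\<lambda>k. (f ^^ k) w \<bullet> b / fact k) k * t ^ k) = f (e t) \<bullet> b"
      unfolding f_e bounded_linear.suminf[OF bounded_linear_inner_left[of b] f_summ[of t]]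
      by (intro suminf_cong) (simp add: diffs_def field_simps del: of_nat_Suc)
    ultimately show ?thesis by (simp add: comp has_real_derivative_iff_has_vector_derivative)
  qed
  then show "((\<lambda>t. \<Sum>k. (t ^ k / fact k) *\<^sub>R (f ^^ k) w) has_vector_derivative
           f (\<Sum>k. (t ^ k / fact k) *\<^sub>R (f ^^ k) w)) (at t)"
    unfolding has_vector_derivative_def
    by (subst has_derivative_componentwise_within) (simp add: e_def)
qed

lemma exp_series_at_0: "(\<Sum>k. ((0::real) ^ k / fact k) *\<^sub>R x k) = x 0"
  for x :: "nat \<Rightarrow> 'a::real_normed_vector"
proof -
  have "(\<lambda>k. ((0::real) ^ k / fact k) *\<^sub>R x k) = (\<lambda>k. if k = 0 then x k else 0)" by auto
  then show ?thesis using sums_unique[OF sums_single[of 0 x]] by simp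
qed

lemma linear_ode_solution_exists:
  fixes f :: "'a::euclidean_space \<Rightarrow> 'a"
  assumes "linear f"
  obtains w :: "real \<Rightarrow> 'a" where "w 0 = w0" "\<And>t. (w has_vector_derivative f (w t)) (at t)"
proof
  let ?w = "\<lambda>t::real. \<Sum>k. (t ^ k / fact k) *\<^sub>R (f ^^ k) w0"
  show "?w 0 = w0" unfolding exp_series_at_0 by simp
qed (rule linear_ode_has_solution[OF assms])

lemma mexp_scaleR_series:
  fixes A :: "real^'n^'n"
  shows "mexp (t *\<^sub>R A) = (\<Sum>k. (t ^ k / fact k) *\<^sub>R ((**) A ^^ k) (mat 1))"
proof -
  have "((**) (t *\<^sub>R A) ^^ k) X = t ^ k *\<^sub>R ((**) A ^^ k) X" for k and X :: "real^'n^'n"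
    by (induction k) (simp_all add: mm.scaleR_left mm.scaleR_right)
  then show ?thesis by (simp add: mexp_def mpow_def divide_inverse mult_ac)
qed

lemma mexp_has_vector_derivative:
  "((\<lambda>t. mexp (t *\<^sub>R A)) has_vector_derivative A ** mexp (t *\<^sub>R A)) (at t within S)"
  unfolding mexp_scaleR_series
  by (rule has_vector_derivative_at_within) (rule linear_ode_has_solution[OF linear_matrix_mult_left])

lemma mexp_0: "mexp 0 = mat 1"
  using mexp_scaleR_series[of 0 0] unfolding exp_series_at_0 by simp

lemma mexp_commute: "mexp (t *\<^sub>R A) ** A = A ** mexp (t *\<^sub>R A)"
proof -
  have pow: "((**) A ^^ k) (mat 1) ** A = A ** ((**) A ^^ k) (mat 1)" for k
    by (induction k) (simp_all add: matrix_mul_assoc[symmetric])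
  note summ = linear_ode_has_solution(1)[OF linear_matrix_mult_left[of A], of t "mat 1"]
  show ?thesis
    unfolding mexp_scaleR_series
    using bounded_linear.suminf[OF mm.bounded_linear_left[of A] summ]
      bounded_linear.suminf[OF mm.bounded_linear_right[of A] summ]
    by (simp add: mm.scaleR_left mm.scaleR_right pow)
qed

lemma diag_mult_vector: "(diag d *v v) $ i = d $ i * v $ i"
  by (simp add: diag_def matrix_vector_mult_def if_distrib[of "\<lambda>x. x * _"] cong: if_cong)

text \<open>Multiplication of component \<open>i\<close> by the integrating factor \<open>exp (- d i * t)\<close> gives a
  constant; the product rule for indefinite integrals makes this valid for the integral form of the equation.\<close>

lemma diag_ode_solution:
  assumes ode: "\<And>t. 0 \<le> t \<Longrightarrow> ((\<lambda>s. diag d *v e s) has_integral e t - c) {0..t}" and "0 \<le> t"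
  shows "e t $ i = exp (d $ i * t) * c $ i"
proof -
  have e0: "e 0 = c" using ode[of 0] by (simp add: has_integral_iff)
  have ode_i: "((\<lambda>s. d $ i * e s $ i) has_integral e t $ i - e 0 $ i) {0..t}" if "0 \<le> t" for t
    using has_integral_linear[OF ode[OF that] bounded_linear_vec_nth[of i]]
    by (simp add: o_def diag_mult_vector e0)
  define E where "E s = exp (- (d $ i * s))" for s
  have E: "((\<lambda>s. - (d $ i) * E s) has_integral E t - E 0) {0..t}" if "0 \<le> t" for t
  proof (rule fundamental_theorem_of_calculus[OF that])
    show "(E has_vector_derivative - (d $ i) * E s) (at s within {0..t})" for s
      unfolding E_def has_real_derivative_iff_has_vector_derivative[symmetric]
      by (auto intro!: derivative_eq_intros)
  qed
  have "continuous_on {0..t} (\<lambda>s. e s $ i)"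
    by (rule continuous_on_if_has_integral[of 0 t "\<lambda>s. d $ i * e s $ i"]) (simp add: ode_i)
  then have "(\<lambda>s. d $ i * e s $ i) absolutely_integrable_on {0..t}"
    by (rule absolutely_integrable_continuous_real[OF continuous_on_mult_left])
  moreover have "(\<lambda>s. - (d $ i) * E s) absolutely_integrable_on {0..t}"
    unfolding E_def by (intro absolutely_integrable_continuous_real continuous_intros)
  ultimately have "((\<lambda>s. - (d $ i) * E s * e s $ i + E s * (d $ i * e s $ i)) has_integral
      E t * e t $ i - E 0 * e 0 $ i) {0..t}"
    using \<open>0 \<le> t\<close> E ode_i by (intro has_integral_product_rule bounded_bilinear_mult) auto
  moreover have "(\<lambda>s. - (d $ i) * E s * e s $ i + E s * (d $ i * e s $ i)) = (\<lambda>s. 0)" by auto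
  ultimately have "E t * e t $ i = c $ i" by (auto simp: E_def e0)
  then show ?thesis by (simp add: E_def exp_minus field_simps)
qed

lemma diag_mexp_unique:
  fixes d :: "real^'n"
  assumes ode: "\<And>t. 0 \<le> t \<Longrightarrow> ((\<lambda>s. diag d *v e s) has_integral e t - c) {0..t}" and "0 \<le> t"
  shows "e t = mexp (t *\<^sub>R diag d) *v c"
proof -
  have "((\<lambda>s. diag d *v (mexp (s *\<^sub>R diag d) *v c)) has_integral mexp (t *\<^sub>R diag d) *v c - c) {0..t}"
    if "0 \<le> t" for t
    using fundamental_theorem_of_calculus[OF that
        bounded_linear.has_vector_derivative[OF mv.bounded_linear_left mexp_has_vector_derivative]]
    by (simp add: mexp_0 matrix_vector_mul_assoc)
  from diag_ode_solution[OF ode \<open>0 \<le> t\<close>] diag_ode_solution[OF this \<open>0 \<le> t\<close>] show ?thesis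
    by (simp add: vec_eq_iff)
qed

text \<open>The derivative of the assumed identity: along this orbit \<open>\<Gamma>\<close> exchanges the dynamics
  \<open>M\<close> and \<open>diag d\<close>.\<close>

lemma mexp_intertwining:
  fixes M \<Gamma> :: "real^'n^'n" and d v w :: "real^'n"
  assumes "\<forall>t\<ge>0. mexp (t *\<^sub>R M) *v v = \<Gamma> *v (mexp (t *\<^sub>R diag d) *v w)" and "0 \<le> t"
  shows "M *v (\<Gamma> *v (mexp (t *\<^sub>R diag d) *v w)) = \<Gamma> *v (diag d *v (mexp (t *\<^sub>R diag d) *v w))"
proof -
  have "((\<lambda>t. mexp (t *\<^sub>R M) *v v) has_vector_derivative (M ** mexp (t *\<^sub>R M)) *v v) (at t within {0..t + 1})"
    by (rule bounded_linear.has_vector_derivative[OF mv.bounded_linear_left mexp_has_vector_derivative])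
  moreover have "((\<lambda>t. \<Gamma> *v (mexp (t *\<^sub>R diag d) *v w)) has_vector_derivative
      \<Gamma> *v ((diag d ** mexp (t *\<^sub>R diag d)) *v w)) (at t within {0..t + 1})"
    by (rule bounded_linear.has_vector_derivative[OF mv.bounded_linear_right
          bounded_linear.has_vector_derivative[OF mv.bounded_linear_left mexp_has_vector_derivative]])
  then have "((\<lambda>t. mexp (t *\<^sub>R M) *v v) has_vector_derivative
      \<Gamma> *v ((diag d ** mexp (t *\<^sub>R diag d)) *v w)) (at t within {0..t + 1})"
    using assms by (intro has_vector_derivative_transform[of t "{0..t + 1}" "\<lambda>t. mexp (t *\<^sub>R M) *v v"]) auto
  ultimately have "(M ** mexp (t *\<^sub>R M)) *v v = \<Gamma> *v ((diag d ** mexp (t *\<^sub>R diag d)) *v w)"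
    using vector_derivative_unique_within_closed_interval[of 0 "t + 1" t] \<open>0 \<le> t\<close> by simp
  then show ?thesis using assms by (simp add: matrix_vector_mul_assoc[symmetric])
qed


section \<open>Trajectories of linear systems\<close>

lemma trajectory_if_derivative:
  assumes "continuous_on {0..} u" and "x 0 = x0"
    and "\<And>t. (x has_vector_derivative A *v x t + B *v u t) (at t)"
  shows "trajectory A B x0 u x"
  unfolding trajectory_def
proof (intro conjI allI impI)
  fix t :: real assume "0 \<le> t"
  show "u absolutely_integrable_on {0..t}"
    by (rule absolutely_integrable_continuous_real[OF continuous_on_subset[OF assms(1)]]) auto
  show "((\<lambda>s. A *v x s + B *v u s) has_integral x t - x0) {0..t}"
    unfolding assms(2)[symmetric]
    by (rule fundamental_theorem_of_calculus[OF \<open>0 \<le> t\<close> has_vector_derivative_at_within[OF assms(3)]])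
qed

lemma linear_feedback_trajectory_exists:
  assumes "linear \<kappa>"
  shows "\<exists>x. trajectory A B x0 (\<lambda>t. \<kappa> (x t)) x"
proof -
  have "linear (\<lambda>v. A *v v + B *v \<kappa> v)"
    using assms by (intro linear_compose_add linear_compose[of \<kappa> "(*v) B", unfolded o_def]) auto
  then obtain x where x: "x 0 = x0" "\<And>t. (x has_vector_derivative A *v x t + B *v \<kappa> (x t)) (at t)"
    by (rule linear_ode_solution_exists[of _ x0]) blast
  have "continuous_on {0..} x"
    using x(2) has_vector_derivative_continuous continuous_at_imp_continuous_on by blast
  then have "continuous_on {0..} (\<lambda>t. \<kappa> (x t))"
    using assms by (rule linear_continuous_on_compose)
  then show ?thesis using x trajectory_if_derivative by blast
qed

lemma trajectory_restrict:
  assumes traj: "trajectory A B x0 u x" and "0 \<le> a" "a \<le> b"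
  shows trajectory_start: "x 0 = x0"
    and trajectory_continuous: "continuous_on {a..b} x"
    and trajectory_input_integrable: "u absolutely_integrable_on {a..b}"
    and trajectory_velocity_integrable: "(\<lambda>s. A *v x s + B *v u s) absolutely_integrable_on {a..b}"
    and trajectory_increment: "((\<lambda>s. A *v x s + B *v u s) has_integral x b - x a) {a..b}"
proof -
  have int: "((\<lambda>s. A *v x s + B *v u s) has_integral x t - x0) {0..t}" if "0 \<le> t" for t
    using traj that by (simp add: trajectory_def)
  show start: "x 0 = x0" using int[of 0] by (simp add: has_integral_iff)
  have "continuous_on {0..b} x"
    by (rule continuous_on_if_has_integral) (use int start in auto)
  then show cont: "continuous_on {a..b} x"
    using \<open>0 \<le> a\<close> by (rule_tac continuous_on_subset) auto
  have "u absolutely_integrable_on {0..b}" using traj assms by (simp add: trajectory_def)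
  then show u: "u absolutely_integrable_on {a..b}"
    using \<open>0 \<le> a\<close> absolutely_integrable_on_subinterval by fastforce
  show "(\<lambda>s. A *v x s + B *v u s) absolutely_integrable_on {a..b}"
    using absolutely_integrable_continuous_real[OF linear_continuous_on_compose[OF cont, of "(*v) A"]]
      absolutely_integrable_linear[OF u, of "(*v) B"]
    by (intro set_integral_add) (auto simp: o_def)
  have "integral {0..a} (\<lambda>s. A *v x s + B *v u s) + integral {a..b} (\<lambda>s. A *v x s + B *v u s)
      = integral {0..b} (\<lambda>s. A *v x s + B *v u s)"
    using int[of b] assms by (intro Henstock_Kurzweil_Integration.integral_combine) auto
  then have "integral {a..b} (\<lambda>s. A *v x s + B *v u s) = x b - x a"
    using integral_unique[OF int[of a]] integral_unique[OF int[of b]] assms by (simp add: algebra_simps)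
  moreover have "(\<lambda>s. A *v x s + B *v u s) integrable_on {a..b}"
    using assms by (intro integrable_on_subinterval[OF has_integral_integrable[OF int[of b]]]) auto
  ultimately show "((\<lambda>s. A *v x s + B *v u s) has_integral x b - x a) {a..b}"
    by (simp add: has_integral_iff)
qed

lemma trajectory_measurable:
  assumes traj: "trajectory A B x0 u x" and "0 \<le> a" "a \<le> b"
  shows "x \<in> borel_measurable (lebesgue_on {a..b})" and "u \<in> borel_measurable (lebesgue_on {a..b})"
  using continuous_imp_measurable_on_sets_lebesgue[OF trajectory_continuous[OF assms]]
    absolutely_integrable_imp_borel_measurable[OF trajectory_input_integrable[OF assms]] by auto

text \<open>Both estimates on the cost come from such forms: constant \<open>W\<close> is used with the
  Riccati matrix, time-dependent \<open>W\<close> with the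
  observability Gramian.\<close>

lemma quadratic_form_along_trajectory:
  assumes traj: "trajectory A B x0 u x" and ab: "0 \<le> a" "a \<le> b"
    and W: "\<And>s. s \<in> {a..b} \<Longrightarrow> (W has_vector_derivative W' s) (at s within {a..b})"
    and W': "continuous_on {a..b} W'"
  shows "((\<lambda>s. (A *v x s + B *v u s) \<bullet> (W s *v x s)
             + x s \<bullet> (W' s *v x s + W s *v (A *v x s + B *v u s)))
           has_integral x b \<bullet> (W b *v x b) - x a \<bullet> (W a *v x a)) {a..b}"
proof -
  have x: "((\<lambda>s. A *v x s + B *v u s) has_integral x t - x a) {a..t}"
      "(\<lambda>s. A *v x s + B *v u s) absolutely_integrable_on {a..t}" if "t \<in> {a..b}" for t
    using trajectory_increment[OF traj] trajectory_velocity_integrable[OF traj] that ab by auto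
  have W_int: "(W' has_integral W t - W a) {a..t}" if "t \<in> {a..b}" for t
    using that by (intro fundamental_theorem_of_calculus has_vector_derivative_within_subset[OF W]) auto
  have W_abs: "W' absolutely_integrable_on {a..t}" if "t \<in> {a..b}" for t
    using that by (intro absolutely_integrable_continuous_real continuous_on_subset[OF W']) auto
  have Wx: "((\<lambda>s. W' s *v x s + W s *v (A *v x s + B *v u s)) has_integral W t *v x t - W a *v x a) {a..t}"
      "(\<lambda>s. W' s *v x s + W s *v (A *v x s + B *v u s)) absolutely_integrable_on {a..t}"
    if "t \<in> {a..b}" for t
    using that has_integral_product_rule[OF bounded_bilinear_matrix_vector_mult _ W_abs[OF that] x(2)[OF that], of W x]
      W_int x(1) by auto
  show ?thesis
    using ab by (intro has_integral_product_rule(1)[OF bounded_bilinear_inner] x Wx) auto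
qed


section \<open>Observability\<close>

text \<open>The observability Gramian \<open>G t = \<integral> N\<close> over \<open>[0, t]\<close>, with integrand discounted by
  \<open>exp (- r)\<close>. Since \<open>N' = A\<^sup>T N + N A - N\<close>, integration gives a linear differential equation for
  \<open>G\<close>. The discount produces the extra term \<open>- G\<close>, which in the observability inequality
  completes the square in \<open>x\<close> and the input.\<close>

lemma discounted_gramian:
  fixes A :: "real^'n^'n" and D :: "real^'n^'p"
  defines "N \<equiv> \<lambda>r. exp (- r) *\<^sub>R (transpose (D ** mexp (r *\<^sub>R A)) ** (D ** mexp (r *\<^sub>R A)))"
  shows "continuous_on S N"
    and "x \<bullet> (N r *v x) = exp (- r) * (norm (D *v (mexp (r *\<^sub>R A) *v x)))\<^sup>2"
    and "0 \<le> t \<Longrightarrow> N t = transpose D ** D + transpose A ** integral {0..t} N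
           + integral {0..t} N ** A - integral {0..t} N"
proof -
  show "x \<bullet> (N r *v x) = exp (- r) * (norm (D *v (mexp (r *\<^sub>R A) *v x)))\<^sup>2"
    by (simp add: N_def mv.scaleR_left inner_transpose_mult matrix_vector_mul_assoc)
  have N': "(N has_vector_derivative transpose A ** N r + N r ** A - N r) (at r within U)" for r U
  proof -
    let ?F = "D ** mexp (r *\<^sub>R A)"
    have F: "((\<lambda>r. D ** mexp (r *\<^sub>R A)) has_vector_derivative ?F ** A) (at r within U)"
      using bounded_linear.has_vector_derivative[OF mm.bounded_linear_right mexp_has_vector_derivative]
      by (simp add: mexp_commute matrix_mul_assoc[symmetric])
    have "(N has_vector_derivative
        exp (- r) *\<^sub>R (transpose ?F ** (?F ** A) + transpose (?F ** A) ** ?F)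
        + (- exp (- r)) *\<^sub>R (transpose ?F ** ?F)) (at r within U)"
      unfolding N_def
      by (intro has_vector_derivative_scaleR mm.has_vector_derivative
          bounded_linear.has_vector_derivative[OF bounded_linear_transpose] F)
        (auto intro!: derivative_eq_intros)
    then show ?thesis
      by (simp add: N_def matrix_transpose_mul matrix_mul_assoc mm.scaleR_left mm.scaleR_right scaleR_add_right
          add.commute)
  qed
  then show cont: "continuous_on S N" for S
    using has_vector_derivative_continuous by (metis continuous_on_eq_continuous_within)
  assume "0 \<le> t"
  define G where "G = integral {0..t} N"
  have "N integrable_on {0..t}" by (intro integrable_continuous_real cont)
  then have G: "(N has_integral G) {0..t}" by (simp add: G_def integrable_integral)
  have "((\<lambda>r. transpose A ** N r + N r ** A - N r) has_integral transpose A ** G + G ** A - G) {0..t}"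
    by (intro has_integral_add has_integral_diff G
        has_integral_linear[OF G mm.bounded_linear_left, unfolded o_def]
        has_integral_linear[OF G mm.bounded_linear_right, unfolded o_def])
  moreover have "((\<lambda>r. transpose A ** N r + N r ** A - N r) has_integral N t - N 0) {0..t}"
    by (intro fundamental_theorem_of_calculus \<open>0 \<le> t\<close> N')
  ultimately have "N t - N 0 = transpose A ** G + G ** A - G" using has_integral_unique by blast
  moreover have "N 0 = transpose D ** D" by (simp add: N_def mexp_0)
  ultimately show "N t = transpose D ** D + transpose A ** integral {0..t} N
           + integral {0..t} N ** A - integral {0..t} N"
    by (simp add: G_def algebra_simps)
qed

text \<open>Over a window of fixed length \<open>\<tau>\<close>, the energy of output and input bounds the initial state. The weight
  \<open>W s = G (t + \<tau> - s)\<close> runs from the full Gramian at the start of the window to zero at its end. With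
  \<open>D\<close> the output matrix, the rate of change of \<open>x \<bullet> W x\<close> is
  \<open>(x + B u) \<bullet> W (x + B u) - |D x|^2 - B u \<bullet> W B u\<close>,
  so the total loss \<open>x t \<bullet> G \<tau> (x t)\<close> is at most the energy, up to a constant, and
  \<open>G \<tau>\<close> is positive definite by observability.\<close>

lemma observability_inequality:
  fixes A :: "real^'n^'n" and B :: "real^'m^'n" and D :: "real^'n^'p"
  assumes "observable D A"
  obtains \<tau> c where "0 < \<tau>" "0 < c"
    "\<And>x0 u x t. trajectory A B x0 u x \<Longrightarrow> 0 \<le> t \<Longrightarrow>
       (\<lambda>s. (norm (D *v x s))\<^sup>2 + (norm (u s))\<^sup>2) integrable_on {t..t + \<tau>} \<Longrightarrow>
       (norm (x t))\<^sup>2 \<le> c * integral {t..t + \<tau>} (\<lambda>s. (norm (D *v x s))\<^sup>2 + (norm (u s))\<^sup>2)"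
proof -
  obtain \<tau> where "0 < \<tau>" and obs:
    "\<And>x y. (\<And>t. t \<in> {0..\<tau>} \<Longrightarrow> D *v (mexp (t *\<^sub>R A) *v x) = D *v (mexp (t *\<^sub>R A) *v y)) \<Longrightarrow> x = y"
    using assms unfolding observable_def by metis
  define N where "N r = exp (- r) *\<^sub>R (transpose (D ** mexp (r *\<^sub>R A)) ** (D ** mexp (r *\<^sub>R A)))" for r
  note N_cont = discounted_gramian(1)[where D = D and A = A, folded N_def]
    and N_form = discounted_gramian(2)[where D = D and A = A, folded N_def]
    and N_eq = discounted_gramian(3)[where D = D and A = A, folded N_def]
  define G where "G t = integral {0..t} N" for t
  have N_int: "N integrable_on {0..t}" for t by (intro integrable_continuous_real N_cont)
  have G_form: "x \<bullet> (G t *v x) = integral {0..t} (\<lambda>r. x \<bullet> (N r *v x))" for x t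
    using integral_linear[OF N_int[of t] bounded_linear_compose[OF bounded_linear_inner_right mv.bounded_linear_left], of x x]
    by (simp add: o_def G_def)
  have form_cont: "continuous_on U (\<lambda>r. x \<bullet> (N r *v x))" for x U
    by (intro continuous_intros bounded_linear.continuous_on[OF mv.bounded_linear_left] N_cont)
  have form_nonneg: "0 \<le> x \<bullet> (N r *v x)" for x r by (simp add: N_form)
  have G_nonneg: "0 \<le> x \<bullet> (G t *v x)" for x t
    unfolding G_form using form_nonneg
    by (intro Henstock_Kurzweil_Integration.integral_nonneg integrable_continuous_real form_cont) auto
  have "0 < x \<bullet> (G \<tau> *v x)" if "x \<noteq> 0" for x
  proof (rule ccontr)
    assume "\<not> 0 < x \<bullet> (G \<tau> *v x)"
    then have "integral {0..\<tau>} (\<lambda>r. x \<bullet> (N r *v x)) = 0"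
      using G_nonneg[of x \<tau>] unfolding G_form by simp
    then have "\<forall>r\<in>{0..\<tau>}. x \<bullet> (N r *v x) = 0"
      using integral_eq_0_iff[OF form_cont \<open>0 < \<tau>\<close> form_nonneg] by simp
    then have "x = 0" by (intro obs) (simp add: N_form)
    with that show False by simp
  qed
  then obtain g where g: "0 < g" "\<And>x. g * (norm x)\<^sup>2 \<le> x \<bullet> (G \<tau> *v x)"
    using coercive_if_pos_def_form by blast
  have G_deriv: "(G has_vector_derivative N t) (at t within {0..\<tau>})" if "t \<in> {0..\<tau>}" for t
    unfolding G_def by (rule integral_has_vector_derivative[OF N_cont that])
  then have "continuous_on {0..\<tau>} G"
    using has_vector_derivative_continuous by (metis continuous_on_eq_continuous_within)
  then have "bounded (G ` {0..\<tau>})" by (intro compact_imp_bounded compact_continuous_image) auto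
  then obtain b where b: "0 < b" "\<And>t. t \<in> {0..\<tau>} \<Longrightarrow> norm (G t) \<le> b"
    by (auto simp: bounded_pos)
  obtain K where K: "0 < K" "\<And>(W :: real^'n^'n) x. norm (W *v x) \<le> norm W * norm x * K"
    using mv.pos_bounded by metis
  obtain L where L: "0 < L" "\<And>u. norm (B *v u) \<le> norm u * L"
    using bounded_linear.pos_bounded[OF mv.bounded_linear_right[of B]] by blast
  \<comment> \<open>A bound for the input term \<open>B u \<bullet> G B u\<close>, uniform over the window.\<close>
  define \<beta> where "\<beta> = b * K * L\<^sup>2"
  have "0 < \<beta>" using b K L by (simp add: \<beta>_def)
  have G_input: "(B *v u) \<bullet> (G t *v (B *v u)) \<le> \<beta> * (norm u)\<^sup>2" if "t \<in> {0..\<tau>}" for t u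
  proof -
    have "(B *v u) \<bullet> (G t *v (B *v u)) \<le> norm (B *v u) * (norm (G t) * norm (B *v u) * K)"
      by (rule order_trans[OF norm_cauchy_schwarz mult_left_mono[OF K(2)]]) simp
    also have "\<dots> = norm (G t) * K * (norm (B *v u))\<^sup>2" by (simp add: power2_eq_square)
    also have "\<dots> \<le> b * K * (norm u * L)\<^sup>2"
      using b(2)[OF that] b(1) K(1) L by (intro mult_mono power_mono) auto
    finally show ?thesis by (simp add: \<beta>_def power_mult_distrib mult_ac)
  qed
  show thesis
  proof (rule that)
    show "0 < \<tau>" by fact
    show "0 < max 1 \<beta> / g" using g(1) by simp
    fix x0 u x and t :: real
    assume traj: "trajectory A B x0 u x" and "0 \<le> t"
      and int: "(\<lambda>s. (norm (D *v x s))\<^sup>2 + (norm (u s))\<^sup>2) integrable_on {t..t + \<tau>}"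
    define W where "W s = G (t + \<tau> - s)" for s
    have W: "(W has_vector_derivative - N (t + \<tau> - s)) (at s within {t..t + \<tau>})"
      if "s \<in> {t..t + \<tau>}" for s
    proof -
      have img: "(\<lambda>s. t + \<tau> - s) ` {t..t + \<tau>} = {0..\<tau>}"
        by (auto intro!: image_eqI[of _ _ "t + \<tau> - r" for r])
      have "((\<lambda>s. t + \<tau> - s) has_vector_derivative - 1) (at s within {t..t + \<tau>})"
        by (auto intro!: derivative_eq_intros)
      from vector_diff_chain_within[OF this, of G "N (t + \<tau> - s)"] show ?thesis
        using G_deriv[of "t + \<tau> - s"] that by (simp add: img W_def[abs_def] o_def)
    qed
    have W': "continuous_on {t..t + \<tau>} (\<lambda>s. - N (t + \<tau> - s))"
      by (intro continuous_intros continuous_on_compose2[OF N_cont[of UNIV]]) auto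
    have "((\<lambda>s. (A *v x s + B *v u s) \<bullet> (W s *v x s)
             + x s \<bullet> ((- N (t + \<tau> - s)) *v x s + W s *v (A *v x s + B *v u s)))
           has_integral x (t + \<tau>) \<bullet> (W (t + \<tau>) *v x (t + \<tau>)) - x t \<bullet> (W t *v x t)) {t..t + \<tau>}"
      using \<open>0 \<le> t\<close> \<open>0 < \<tau>\<close> by (intro quadratic_form_along_trajectory[OF traj] W W') auto
    moreover have "W (t + \<tau>) = 0" "W t = G \<tau>" by (simp_all add: W_def G_def)
    ultimately have form: "((\<lambda>s. (A *v x s + B *v u s) \<bullet> (W s *v x s)
             + x s \<bullet> ((- N (t + \<tau> - s)) *v x s + W s *v (A *v x s + B *v u s)))
           has_integral - (x t \<bullet> (G \<tau> *v x t))) {t..t + \<tau>}" by simp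
    have rate: "- (max 1 \<beta> * ((norm (D *v x s))\<^sup>2 + (norm (u s))\<^sup>2)) \<le>
        (A *v x s + B *v u s) \<bullet> (W s *v x s)
        + x s \<bullet> ((- N (t + \<tau> - s)) *v x s + W s *v (A *v x s + B *v u s))"
      if "s \<in> {t..t + \<tau>}" for s
    proof -
      have s: "t + \<tau> - s \<in> {0..\<tau>}" using that by auto
      have "N (t + \<tau> - s) = transpose D ** D + transpose A ** W s + W s ** A - W s"
        using N_eq[of "t + \<tau> - s"] s by (simp add: W_def G_def)
      then have "x s \<bullet> (N (t + \<tau> - s) *v x s) = (norm (D *v x s))\<^sup>2 + (A *v x s) \<bullet> (W s *v x s)
          + x s \<bullet> (W s *v (A *v x s)) - x s \<bullet> (W s *v x s)"
        by (simp add: mv.add_left mv.diff_left inner_add_right inner_diff_right power2_norm_eq_inner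
            matrix_vector_mul_assoc[symmetric] inner_transpose_right del: transpose_matrix_vector)
      then have "(A *v x s + B *v u s) \<bullet> (W s *v x s)
        + x s \<bullet> ((- N (t + \<tau> - s)) *v x s + W s *v (A *v x s + B *v u s))
        = (x s + B *v u s) \<bullet> (W s *v (x s + B *v u s))
          - (norm (D *v x s))\<^sup>2 - (B *v u s) \<bullet> (W s *v (B *v u s))"
        unfolding mv.add_right mv.minus_left inner_add_left inner_add_right inner_minus_right by linarith
      moreover have "0 \<le> (x s + B *v u s) \<bullet> (W s *v (x s + B *v u s))"
        by (simp add: W_def G_nonneg)
      moreover have "(B *v u s) \<bullet> (W s *v (B *v u s)) \<le> \<beta> * (norm (u s))\<^sup>2"
        using G_input[OF s] by (simp add: W_def)
      moreover have "\<beta> * (norm (u s))\<^sup>2 \<le> max 1 \<beta> * (norm (u s))\<^sup>2"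
        by (intro mult_right_mono) auto
      moreover have "1 * (norm (D *v x s))\<^sup>2 \<le> max 1 \<beta> * (norm (D *v x s))\<^sup>2"
        by (intro mult_right_mono) auto
      ultimately show ?thesis unfolding distrib_left by linarith
    qed
    have "- (max 1 \<beta> * integral {t..t + \<tau>} (\<lambda>s. (norm (D *v x s))\<^sup>2 + (norm (u s))\<^sup>2))
        \<le> - (x t \<bullet> (G \<tau> *v x t))"
      by (rule has_integral_le[OF has_integral_neg[OF has_integral_mult_right[OF integrable_integral[OF int]]] form rate])
    then have "g * (norm (x t))\<^sup>2 \<le> max 1 \<beta> * integral {t..t + \<tau>} (\<lambda>s. (norm (D *v x s))\<^sup>2 + (norm (u s))\<^sup>2)"
      using g(2)[of "x t"] by linarith
    then show "(norm (x t))\<^sup>2 \<le> max 1 \<beta> / g * integral {t..t + \<tau>} (\<lambda>s. (norm (D *v x s))\<^sup>2 + (norm (u s))\<^sup>2)"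
      using g(1) by (simp add: field_simps)
  qed
qed


section \<open>The linear-quadratic problem\<close>

text \<open>Monotone convergence: a bound on the cost over the half-line is a uniform bound on its finite-horizon
  parts. This connects the cost, an extended nonnegative Lebesgue integral, with the gauge integrals in which
  the calculus along trajectories is done.\<close>

lemma nn_integral_halfline_le_iff:
  fixes l :: "real \<Rightarrow> real"
  assumes meas: "\<And>t. 0 \<le> t \<Longrightarrow> l \<in> borel_measurable (lebesgue_on {0..t})"
    and nonneg: "\<And>t. 0 \<le> l t" and "0 \<le> c"
  shows "(\<integral>\<^sup>+ t\<in>{0..}. ennreal (l t) \<partial>lebesgue) \<le> ennreal c \<longleftrightarrow>
    (\<forall>t\<ge>0. l integrable_on {0..t} \<and> integral {0..t} l \<le> c)"
proof -
  define r where "r t s = (if s \<in> {0..t} then l s else 0)" for t s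
  have r_meas: "r t \<in> borel_measurable lebesgue" if "0 \<le> t" for t
    using meas[OF that] unfolding r_def by (intro borel_measurable_if_I) auto
  have r_nonneg: "0 \<le> r t s" for t s using nonneg by (simp add: r_def)
  have r_integral: "(r t has_integral q) UNIV \<longleftrightarrow> (l has_integral q) {0..t}" for t q
    unfolding r_def by (rule has_integral_restrict_UNIV)
  show ?thesis
  proof (intro iffI allI impI)
    fix t :: real assume le: "(\<integral>\<^sup>+ t\<in>{0..}. ennreal (l t) \<partial>lebesgue) \<le> ennreal c" and "0 \<le> t"
    have "integral\<^sup>N lebesgue (r t) \<le> (\<integral>\<^sup>+ t\<in>{0..}. ennreal (l t) \<partial>lebesgue)"
      by (intro nn_integral_mono) (auto simp: r_def indicator_def)
    with le have "integral\<^sup>N lebesgue (r t) \<le> ennreal c" by simp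
    moreover from this obtain q where q: "integral\<^sup>N lebesgue (r t) = ennreal q" "0 \<le> q"
      by (metis ennreal_cases ennreal_less_top top.not_eq_extremum linorder_not_le)
    ultimately have "q \<le> c" using \<open>0 \<le> c\<close> by simp
    moreover have "(l has_integral q) {0..t}"
      unfolding r_integral[symmetric] using q r_meas[OF \<open>0 \<le> t\<close>] r_nonneg
      by (subst has_integral_iff_nn_integral_lebesgue) auto
    ultimately show "l integrable_on {0..t} \<and> integral {0..t} l \<le> c" by (auto simp: has_integral_iff)
  next
    assume int: "\<forall>t\<ge>0. l integrable_on {0..t} \<and> integral {0..t} l \<le> c"
    have bound: "integral\<^sup>N lebesgue (r (real n)) \<le> ennreal c" for n
    proof -
      have "(r (real n) has_integral integral {0..real n} l) UNIV"
        unfolding r_integral using int by (simp add: integrable_integral)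
      then have "integral\<^sup>N lebesgue (r (real n)) = ennreal (integral {0..real n} l)"
        using has_integral_iff_nn_integral_lebesgue[of "r (real n)"] r_nonneg by simp
      then show ?thesis using int by (simp add: ennreal_leI)
    qed
    have "ennreal (l s) * indicator {0..} s = (SUP n. ennreal (r (real n) s))" for s
    proof (cases "0 \<le> s")
      case True
      obtain n :: nat where "s \<le> real n" using real_arch_simple by blast
      have "(SUP n. ennreal (r (real n) s)) = ennreal (l s)"
      proof (rule antisym)
        show "(SUP n. ennreal (r (real n) s)) \<le> ennreal (l s)"
          by (rule SUP_least) (auto simp: r_def nonneg)
        show "ennreal (l s) \<le> (SUP n. ennreal (r (real n) s))"
          using \<open>s \<le> real n\<close> True by (intro SUP_upper2[of n]) (auto simp: r_def)
      qed
      then show ?thesis using True by simp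
    qed (simp add: r_def)
    then have "(\<integral>\<^sup>+ t\<in>{0..}. ennreal (l t) \<partial>lebesgue) = (\<integral>\<^sup>+ s. (SUP n. ennreal (r (real n) s)) \<partial>lebesgue)"
      by simp
    also have "\<dots> = (SUP n. integral\<^sup>N lebesgue (r (real n)))"
    proof (rule nn_integral_monotone_convergence_SUP)
      show "incseq (\<lambda>n s. ennreal (r (real n) s))"
        by (auto simp: incseq_def le_fun_def r_def nonneg intro!: ennreal_leI)
      show "(\<lambda>s. ennreal (r (real n) s)) \<in> borel_measurable lebesgue" for n
        using r_meas[of "real n"] by (intro measurable_compose[OF _ measurable_ennreal]) auto
    qed
    also have "\<dots> \<le> ennreal c" by (rule SUP_least) (rule bound)
    finally show "(\<integral>\<^sup>+ t\<in>{0..}. ennreal (l t) \<partial>lebesgue) \<le> ennreal c" .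
  qed
qed

definition running_cost ::
  "real^'n^'p \<Rightarrow> real^'p^'p \<Rightarrow> real^'m^'m \<Rightarrow> real^'n \<Rightarrow> real^'m \<Rightarrow> real" where
  "running_cost C Q R x u = (C *v x) \<bullet> (Q *v (C *v x)) + u \<bullet> (R *v u)"

lemma running_cost_nonneg:
  assumes "pos_semidef Q" "pos_def R"
  shows "0 \<le> running_cost C Q R x u"
proof -
  have "0 \<le> u \<bullet> (R *v u)" using assms(2) unfolding pos_def_def by (cases "u = 0") (auto intro: less_imp_le)
  then show ?thesis using assms(1) by (simp add: pos_semidef_def running_cost_def)
qed

lemma measurable_matrix_vector_mult:
  assumes "f \<in> borel_measurable M"
  shows "(\<lambda>s. (S :: real^'n^'m) *v f s) \<in> borel_measurable M"
  by (rule measurable_compose[OF assms borel_measurable_continuous_onI]) (intro linear_continuous_on, simp)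

lemma lq_cost_le_iff:
  assumes traj: "trajectory A B x0 u x" and QR: "pos_semidef Q" "pos_def R" and "0 \<le> c"
  shows "lq_cost C Q R u x \<le> ennreal c \<longleftrightarrow>
    (\<forall>t\<ge>0. (\<lambda>s. running_cost C Q R (x s) (u s)) integrable_on {0..t} \<and>
            integral {0..t} (\<lambda>s. running_cost C Q R (x s) (u s)) \<le> c)"
  unfolding lq_cost_def running_cost_def[symmetric]
proof (rule nn_integral_halfline_le_iff)
  fix t :: real assume "0 \<le> t"
  then show "(\<lambda>s. running_cost C Q R (x s) (u s)) \<in> borel_measurable (lebesgue_on {0..t})"
    unfolding running_cost_def
    by (intro borel_measurable_add borel_measurable_inner measurable_matrix_vector_mult
        trajectory_measurable[OF traj]) auto
qed (use \<open>0 \<le> c\<close> running_cost_nonneg[OF QR] in auto)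

text \<open>The derivative of \<open>x \<bullet> P x\<close> along the dynamics is a square that vanishes exactly for the feedback
  \<open>u = - K x\<close>, minus the running cost.\<close>

lemma riccati_completion_of_squares:
  assumes "pos_def R" and P: "transpose P = P"
    and riccati: "transpose A ** P + P ** A - P ** B ** matrix_inv R ** transpose B ** P
           + transpose C ** Q ** C = 0"
    and K: "K = matrix_inv R ** transpose B ** P"
  shows "(A *v x + B *v u) \<bullet> (P *v x) + x \<bullet> (P *v (A *v x + B *v u))
    = (u + K *v x) \<bullet> (R *v (u + K *v x)) - running_cost C Q R x u"
proof -
  let ?b = "transpose B *v (P *v x)"
  have R: "transpose R = R" using assms(1) by (simp add: pos_def_def)
  have sym: "v \<bullet> (S *v w) = (S *v v) \<bullet> w" if "transpose S = S" for S :: "real^'k^'k" and v w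
    using inner_transpose_right[of v S w] that by simp
  have "R ** K = transpose B ** P"
    unfolding K using matrix_inv_mult(1)[OF pos_def_invertible[OF \<open>pos_def R\<close>]]
    by (simp add: matrix_mul_assoc)
  then have RK: "R *v (K *v x) = ?b"
    unfolding matrix_vector_mul_assoc by (simp only:)
  have Bv: "v \<bullet> ?b = (B *v v) \<bullet> (P *v x)" for v by (rule inner_transpose_right)
  have "x \<bullet> ((transpose A ** P + P ** A - P ** B ** matrix_inv R ** transpose B ** P
           + transpose C ** Q ** C) *v x) = 0"
    unfolding riccati by simp
  moreover have "P ** B ** matrix_inv R ** transpose B ** P = P ** (B ** K)"
    unfolding K by (simp add: matrix_mul_assoc)
  ultimately have "(A *v x) \<bullet> (P *v x) + x \<bullet> (P *v (A *v x)) - x \<bullet> (P *v (B *v (K *v x)))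
      + (C *v x) \<bullet> (Q *v (C *v x)) = 0"
    by (simp add: mv.add_left mv.diff_left inner_add_right inner_diff_right
        matrix_vector_mul_assoc[symmetric] inner_transpose_right del: transpose_matrix_vector)
  moreover have "x \<bullet> (P *v (B *v v)) = v \<bullet> ?b" for v
    unfolding Bv using sym[OF P, of x "B *v v"] by (metis inner_commute)
  moreover have "(K *v x) \<bullet> (R *v u) = u \<bullet> ?b"
    using sym[OF R, of "K *v x" u] unfolding RK by (metis inner_commute)
  ultimately show ?thesis
    by (simp add: running_cost_def mv.add_right inner_add_left inner_add_right RK Bv[symmetric]
        del: transpose_matrix_vector)
qed

lemma riccati_cost_identity:
  assumes "pos_def R" and P: "transpose P = P"
    and riccati: "transpose A ** P + P ** A - P ** B ** matrix_inv R ** transpose B ** P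
           + transpose C ** Q ** C = 0"
    and K: "K = matrix_inv R ** transpose B ** P"
    and traj: "trajectory A B x0 u x" and "0 \<le> t"
  shows "((\<lambda>s. (u s + K *v x s) \<bullet> (R *v (u s + K *v x s)) - running_cost C Q R (x s) (u s))
    has_integral x t \<bullet> (P *v x t) - x0 \<bullet> (P *v x0)) {0..t}"
  using quadratic_form_along_trajectory[OF traj order_refl \<open>0 \<le> t\<close>, of "\<lambda>_. P" "\<lambda>_. 0"]
  by (simp add: riccati_completion_of_squares[OF assms(1-4)] trajectory_start[OF traj order_refl order_refl])

lemma riccati_feedback_cost_le:
  assumes "pos_semidef Q" "pos_def R" and P: "pos_def P"
    and riccati: "transpose A ** P + P ** A - P ** B ** matrix_inv R ** transpose B ** P
           + transpose C ** Q ** C = 0"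
    and K: "K = matrix_inv R ** transpose B ** P"
    and traj: "trajectory A B x0 (\<lambda>t. - (K *v x t)) x"
  shows "lq_cost C Q R (\<lambda>t. - (K *v x t)) x \<le> ennreal (x0 \<bullet> (P *v x0))"
proof -
  have P_nonneg: "0 \<le> v \<bullet> (P *v v)" for v
    using P unfolding pos_def_def by (cases "v = 0") (auto intro: less_imp_le)
  have "transpose P = P" using P by (simp add: pos_def_def)
  note identity = riccati_cost_identity[OF \<open>pos_def R\<close> this riccati K traj]
  have "((\<lambda>s. running_cost C Q R (x s) (- (K *v x s))) has_integral x0 \<bullet> (P *v x0) - x t \<bullet> (P *v x t)) {0..t}"
    if "0 \<le> t" for t
    using has_integral_neg[OF identity[OF that]] by simp
  then show ?thesis
    unfolding lq_cost_le_iff[OF traj \<open>pos_semidef Q\<close> \<open>pos_def R\<close> P_nonneg]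
    using P_nonneg by (simp add: has_integral_iff)
qed

text \<open>By the cost identity, the cost up to time \<open>t\<close> is at least \<open>x0 \<bullet> P x0 - x t \<bullet> P (x t)\<close>. If the total
  cost were smaller than \<open>x0 \<bullet> P x0\<close>, the state would therefore stay away from zero. The observability inequality
  would then charge a fixed positive amount of cost to each window of length \<open>\<tau>\<close>, and the total cost would
  be infinite.\<close>

lemma riccati_cost_ge:
  fixes A :: "real^'n^'n" and B :: "real^'m^'n" and C :: "real^'n^'p"
  assumes QR: "pos_semidef Q" "pos_def R" and P: "pos_def P"
    and sqrtQ: "pos_semidef sqrtQ" "sqrtQ ** sqrtQ = Q" and obs: "observable (sqrtQ ** C) A"
    and riccati: "transpose A ** P + P ** A - P ** B ** matrix_inv R ** transpose B ** P
           + transpose C ** Q ** C = 0"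
    and K: "K = matrix_inv R ** transpose B ** P"
    and traj: "trajectory A B x0 u x"
  shows "ennreal (x0 \<bullet> (P *v x0)) \<le> lq_cost C Q R u x"
proof (rule ccontr)
  assume "\<not> ennreal (x0 \<bullet> (P *v x0)) \<le> lq_cost C Q R u x"
  then have less: "lq_cost C Q R u x < ennreal (x0 \<bullet> (P *v x0))" by simp
  then obtain c where c: "lq_cost C Q R u x = ennreal c" "0 \<le> c"
    by (metis ennreal_cases top.not_eq_extremum top_greatest linorder_not_le)
  with less have "c < x0 \<bullet> (P *v x0)" by (simp add: ennreal_less_iff)
  \<comment> \<open>The amount by which the cost would undercut the optimal value; it bounds \<open>x t \<bullet> P (x t)\<close> below for all \<open>t\<close>.\<close>
  define e where "e = x0 \<bullet> (P *v x0) - c"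
  have "0 < e" using \<open>c < x0 \<bullet> (P *v x0)\<close> by (simp add: e_def)
  let ?l = "\<lambda>s. running_cost C Q R (x s) (u s)"
  let ?D = "sqrtQ ** C"
  let ?o = "\<lambda>s. (norm (?D *v x s))\<^sup>2 + (norm (u s))\<^sup>2"
  have cost: "?l integrable_on {0..t}" "integral {0..t} ?l \<le> c" if "0 \<le> t" for t
    using lq_cost_le_iff[OF traj QR c(2), of C] c(1) that by auto
  have PT: "transpose P = P" using P by (simp add: pos_def_def)
  have R_nonneg: "0 \<le> v \<bullet> (R *v v)" for v
    using QR(2) unfolding pos_def_def by (cases "v = 0") (auto intro: less_imp_le)
  have state_large: "e \<le> x t \<bullet> (P *v x t)" if "0 \<le> t" for t
  proof -
    note id = riccati_cost_identity[OF QR(2) PT riccati K traj that]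
    have "- integral {0..t} ?l \<le> x t \<bullet> (P *v x t) - x0 \<bullet> (P *v x0)"
      using R_nonneg by (intro has_integral_le[OF has_integral_neg[OF integrable_integral[OF cost(1)[OF that]]] id]) simp
    then show ?thesis using cost(2)[OF that] by (simp add: e_def)
  qed
  obtain p where p: "0 < p" "\<And>v. v \<bullet> (P *v v) \<le> p * (norm v)\<^sup>2" using quadratic_form_le by blast
  obtain r where r: "0 < r" "\<And>v. r * (norm v)\<^sup>2 \<le> v \<bullet> (R *v v)"
    using coercive_if_pos_def_form[of R] QR(2) unfolding pos_def_def by blast
  obtain \<tau> k where \<tau>: "0 < \<tau>" "0 < k" and ineq:
    "\<And>x0 u x t. trajectory A B x0 u x \<Longrightarrow> 0 \<le> t \<Longrightarrow>
       (\<lambda>s. (norm (?D *v x s))\<^sup>2 + (norm (u s))\<^sup>2) integrable_on {t..t + \<tau>} \<Longrightarrow>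
       (norm (x t))\<^sup>2 \<le> k * integral {t..t + \<tau>} (\<lambda>s. (norm (?D *v x s))\<^sup>2 + (norm (u s))\<^sup>2)"
    by (rule observability_inequality[OF obs, where B = B]) blast
  note obs_ineq = ineq[OF traj]
  \<comment> \<open>Converts the energy of output and input into running cost.\<close>
  define m where "m = max 1 (1 / r)"
  have "0 < m" by (simp add: m_def)
  have o_le: "?o s \<le> m * ?l s" for s
  proof -
    have "(norm (?D *v x s))\<^sup>2 = (C *v x s) \<bullet> (Q *v (C *v x s))"
    proof -
      have "(norm (?D *v x s))\<^sup>2 = (C *v x s) \<bullet> ((transpose sqrtQ ** sqrtQ) *v (C *v x s))"
        unfolding inner_transpose_mult by (simp add: matrix_vector_mul_assoc)
      then show ?thesis using sqrtQ by (simp add: pos_semidef_def)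
    qed
    moreover have "1 * ((C *v x s) \<bullet> (Q *v (C *v x s))) \<le> m * ((C *v x s) \<bullet> (Q *v (C *v x s)))"
      using QR(1) by (intro mult_right_mono) (auto simp: m_def pos_semidef_def)
    moreover have "(norm (u s))\<^sup>2 \<le> 1 / r * (u s \<bullet> (R *v u s))"
      using r by (simp add: field_simps)
    moreover have "1 / r * (u s \<bullet> (R *v u s)) \<le> m * (u s \<bullet> (R *v u s))"
      using R_nonneg by (intro mult_right_mono) (auto simp: m_def)
    ultimately show ?thesis unfolding running_cost_def distrib_left by linarith
  qed
  \<comment> \<open>The cost charged to every window.\<close>
  define d where "d = e / (p * k * m)"
  have "0 < d" using \<open>0 < e\<close> p(1) \<tau>(2) \<open>0 < m\<close> by (simp add: d_def)
  have window: "d \<le> integral {t..t + \<tau>} ?l" if "0 \<le> t" for t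
  proof -
    have l_int: "(\<lambda>s. m * ?l s) integrable_on {t..t + \<tau>}"
      using that \<tau>(1)
      by (intro integrable_on_mult_right integrable_on_subinterval[OF cost(1)[of "t + \<tau>"]]) auto
    have o_int: "?o integrable_on {t..t + \<tau>}"
    proof (rule measurable_bounded_by_integrable_imp_integrable[OF _ l_int])
      show "?o \<in> borel_measurable (lebesgue_on {t..t + \<tau>})"
        using that \<tau>(1)
        by (intro borel_measurable_add borel_measurable_power measurable_compose[OF _ borel_measurable_norm] measurable_matrix_vector_mult
            trajectory_measurable[OF traj]) auto
    qed (use o_le in auto)
    have "e \<le> p * (norm (x t))\<^sup>2" using order_trans[OF state_large[OF that] p(2)] .
    also have "\<dots> \<le> p * (k * integral {t..t + \<tau>} ?o)"
      using p(1) by (intro mult_left_mono obs_ineq[OF that o_int]) auto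
    also have "\<dots> \<le> p * (k * integral {t..t + \<tau>} (\<lambda>s. m * ?l s))"
      using p(1) \<tau>(2) by (intro mult_left_mono integral_le o_int l_int o_le) auto
    finally show ?thesis using p(1) \<tau>(2) \<open>0 < m\<close> by (simp add: d_def field_simps)
  qed
  have "real n * d \<le> integral {0..real n * \<tau>} ?l" for n
  proof (induction n)
    case (Suc n)
    have "integral {0..real n * \<tau>} ?l + integral {real n * \<tau>..real n * \<tau> + \<tau>} ?l
        = integral {0..real n * \<tau> + \<tau>} ?l"
      using \<tau>(1) cost(1)[of "real n * \<tau> + \<tau>"] by (intro Henstock_Kurzweil_Integration.integral_combine) auto
    then show ?case using Suc window[of "real n * \<tau>"] \<tau>(1) by (simp add: algebra_simps)
  qed simp
  then have "real n * d \<le> c" for n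
    using cost(2)[of "real n * \<tau>"] \<tau>(1) by (meson less_imp_le mult_nonneg_nonneg of_nat_0_le_iff order_trans)
  moreover obtain n :: nat where "c < real n * d" using \<open>0 < d\<close> ex_less_of_nat_mult by blast
  ultimately show False by (meson not_le)
qed


section \<open>The filter and the augmented system\<close>

lemma linear_regressor: "linear (\<lambda>(y, u). regressor y u)"
  by (intro linearI) (auto simp: vec_eq_iff regressor_def hcat_def vcat_def row_kron_def kron_def
      rowvector_def algebra_simps split: sum.splits)

text \<open>The parametrization is a statement about trajectories; here it is turned into an identity between
  matrices, namely \<open>T A = M T + G C\<close> and \<open>T B = H\<close>, where \<open>G\<close>, \<open>H\<close> are given by
  \<open>regressor y u *v \<theta> = G y + H u\<close>. It is obtained by differentiating the parametrization at time
  0 along the solution with state \<open>x0\<close>, constant input \<open>u0\<close> and filter state 0.\<close>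

lemma plant_identity_of_filter_parametrization:
  fixes A :: "real^'n^'n" and B :: "real^'m^'n" and C :: "real^'n^'p" and \<theta> :: "real^('p, 'm, 'n) zcol"
  assumes param: "filter_parametrization A B C M T \<theta>"
  shows "T *v (A *v x0 + B *v u0) = M *v (T *v x0) + regressor (C *v x0) u0 *v \<theta>"
proof -
  define f where "f = (\<lambda>w :: (real^'n) \<times> (real^'m) \<times> (real^('p, 'm, 'n) zcol^'n).
    (A *v fst w + B *v fst (snd w), 0 :: real^'m, M ** snd (snd w) + regressor (C *v fst w) (fst (snd w))))"
  have reg: "regressor (y + y') (u + u') = regressor y u + regressor y' u'"
    "regressor (c *\<^sub>R y) (c *\<^sub>R u) = c *\<^sub>R regressor y u"
    for y y' :: "real^'p" and u u' :: "real^'m" and c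
    using linear_add[OF linear_regressor, of "(y, u)" "(y', u')"] linear_scale[OF linear_regressor, of c "(y, u)"]
    by auto
  have "linear f"
    by (intro linearI) (auto simp: f_def mm.add_right mv.add_right mm.scaleR_right mv.scaleR_right reg scaleR_add_right)
  then obtain w where w: "w 0 = (x0, u0, 0)" "\<And>t. (w has_vector_derivative f (w t)) (at t)"
    by (rule linear_ode_solution_exists[of _ "(x0, u0, 0)"]) blast
  define x u Z where "x t = fst (w t)" and "u t = fst (snd (w t))" and "Z t = snd (snd (w t))" for t
  have init: "x 0 = x0" "u 0 = u0" "Z 0 = 0" using w(1) by (simp_all add: x_def u_def Z_def)
  note dfst = bounded_linear.has_vector_derivative[OF bounded_linear_fst]
    and dsnd = bounded_linear.has_vector_derivative[OF bounded_linear_snd]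
  have x': "(x has_vector_derivative A *v x t + B *v u t) (at t)" for t
    using dfst[OF w(2)[of t]] by (simp add: x_def[abs_def] u_def f_def)
  have Z': "(Z has_vector_derivative M ** Z t + regressor (C *v x t) (u t)) (at t)" for t
    using dsnd[OF dsnd[OF w(2)[of t]]] by (simp add: x_def u_def Z_def[abs_def] f_def)
  have "continuous_on {0..} w"
    using w(2) has_vector_derivative_continuous continuous_at_imp_continuous_on by blast
  then have "continuous_on {0..} u"
    unfolding u_def by (intro continuous_intros)
  then have "trajectory A B (x 0) u x" using x' by (intro trajectory_if_derivative) auto
  moreover have "filter_trajectory M (\<lambda>t. C *v x t) u Z"
    unfolding filter_trajectory_def
    using fundamental_theorem_of_calculus[OF _ has_vector_derivative_at_within[OF Z']] by blast
  ultimately have eq: "T *v x t = Z t *v \<theta> + mexp (t *\<^sub>R M) *v (T *v x0)" if "0 \<le> t" for t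
    using param[unfolded filter_parametrization_def, rule_format, OF conjI that] init by simp
  have "((\<lambda>t. T *v x t) has_vector_derivative T *v (A *v x0 + B *v u0)) (at 0 within {0..1})"
    using bounded_linear.has_vector_derivative[OF mv.bounded_linear_right
        has_vector_derivative_at_within[OF x'[of 0]]] init
    by simp
  moreover have "((\<lambda>t. Z t *v \<theta> + mexp (t *\<^sub>R M) *v (T *v x0)) has_vector_derivative
      (M ** Z 0 + regressor (C *v x 0) (u 0)) *v \<theta> + (M ** mexp (0 *\<^sub>R M)) *v (T *v x0)) (at 0 within {0..1})"
    by (intro has_vector_derivative_add
        bounded_linear.has_vector_derivative[OF mv.bounded_linear_left has_vector_derivative_at_within[OF Z']]
        bounded_linear.has_vector_derivative[OF mv.bounded_linear_left mexp_has_vector_derivative])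
  then have "((\<lambda>t. T *v x t) has_vector_derivative
      regressor (C *v x0) u0 *v \<theta> + M *v (T *v x0)) (at 0 within {0..1})"
    by (intro has_vector_derivative_transform[of 0 "{0..1}" "\<lambda>t. T *v x t"]) (auto simp: eq init mexp_0)
  ultimately show ?thesis
    using vector_derivative_unique_within_closed_interval[of 0 1 0] by (simp add: add.commute) 
qed

lemma upper_vcat [simp]: "upper (vcat v w) = v" and lower_vcat [simp]: "lower (vcat v w) = w"
  by (simp_all add: upper_def lower_def vcat_def vec_eq_iff)

lemma bounded_linear_upper: "bounded_linear (upper :: real^('a::finite + 'b::finite) \<Rightarrow> real^'a)"
  and bounded_linear_lower: "bounded_linear (lower :: real^('a + 'b) \<Rightarrow> real^'b)"
  by (auto intro!: linear_conv_bounded_linear[THEN iffD1] linearI simp: upper_def lower_def vec_eq_iff)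

lemma vcat_add: "vcat v w + vcat v' w' = vcat (v + v') (w + w' :: real^'b)"
  by (simp add: vcat_def vec_eq_iff split: sum.splits)

lemma hcat_mult_vector: "hcat U V *v v = U *v upper v + V *v lower v" for v :: "real^('a::finite + 'b::finite)"
  by (simp add: vec_eq_iff matrix_vector_mult_def hcat_def vcat_def upper_def lower_def
      UNIV_Plus_UNIV[symmetric] sum.Plus del: UNIV_Plus_UNIV)

lemma vcat_mult_vector: "vcat U V *v v = vcat (U *v v) (V *v v)" for v :: "real^'a"
  by (auto simp: vec_eq_iff matrix_vector_mult_def vcat_def split: sum.splits)

lemma vec_of_mat_surj: obtains Z where "z = vec_of_mat Z"
proof
  show "z = vec_of_mat (\<chi> i j. z $ (j, i))" by (simp add: vec_of_mat_def vec_eq_iff)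
qed

text \<open>The key step: \<open>x = (\<theta>\<^sup>T \<otimes> inverse T) z + inverse T \<Gamma> \<epsilon>\<close> turns every trajectory of the
  augmented system into the plant trajectory from \<open>x0\<close> with the same input. Writing \<open>z = vec Z\<close>, one has
  \<open>T x = Z \<theta> + \<Gamma> \<epsilon>\<close>, and \<open>Z\<close> is driven by the regressor of \<open>C x\<close> and \<open>u\<close>. Since
  \<open>\<Gamma> \<epsilon>\<close> evolves by \<open>M\<close>, the derivative of \<open>T x\<close> is
  \<open>M (T x) + regressor (C x) u \<theta>\<close>, which is \<open>T (A x + B u)\<close> by \<open>plant_identity_of_filter_parametrization\<close>.\<close>

lemma augmented_trajectory_yields_plant_trajectory:
  fixes A :: "real^'n^'n" and B :: "real^'m^'n" and C :: "real^'n^'p"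
    and M T \<Gamma> :: "real^'n^'n" and \<theta> :: "real^('p, 'm, 'n) zcol"
    and lam x0 :: "real^'n"
  assumes T: "invertible T" and param: "filter_parametrization A B C M T \<theta>"
    and decay: "\<forall>t\<ge>0. mexp (t *\<^sub>R M) *v (T *v x0) = \<Gamma> *v (mexp (t *\<^sub>R diag lam) *v 1)"
    and traj: "trajectory
      (vcat (hcat (A_xi M C \<theta> T) (L_z ** C ** matrix_inv T ** \<Gamma>)) (hcat 0 (diag lam)))
      (vcat B_xi 0) (vcat 0 1) u \<zeta>"
  shows "trajectory A B x0 u
    (\<lambda>t. row_kron \<theta> (matrix_inv T) *v upper (\<zeta> t) + (matrix_inv T ** \<Gamma>) *v lower (\<zeta> t))"
proof -
  \<comment> \<open>The plant state as a function of the augmented state.\<close>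
  define h where "h v = row_kron \<theta> (matrix_inv T) *v upper v + (matrix_inv T ** \<Gamma>) *v lower v"
    for v :: "real^((('p, 'm, 'n) zcol \<times> 'n) + 'n)"
  let ?F = "vcat (hcat (A_xi M C \<theta> T) (L_z ** C ** matrix_inv T ** \<Gamma>)) (hcat 0 (diag lam))"
  let ?G = "vcat B_xi 0 :: real^'m^((('p, 'm, 'n) zcol \<times> 'n) + 'n)"
  have T_inv: "T *v (matrix_inv T *v v) = v" "matrix_inv T *v (T *v v) = v" for v
    using matrix_inv_mult[OF T] by (simp_all add: matrix_vector_mul_assoc)
  have h: "bounded_linear h"
    unfolding h_def by (intro bounded_linear_add
        bounded_linear_compose[OF mv.bounded_linear_right bounded_linear_upper]
        bounded_linear_compose[OF mv.bounded_linear_right bounded_linear_lower])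
  have velocity: "?F *v v + ?G *v w =
      vcat (A_z M *v upper v + vec_of_mat (regressor (C *v h v) w)) (diag lam *v lower v)" for v w
    by (simp add: vcat_mult_vector hcat_mult_vector vcat_add vec_of_mat_regressor A_xi_def C_xi_def h_def
        mv.add_left mv.add_right matrix_vector_mul_assoc[symmetric] algebra_simps)
  have int: "((\<lambda>s. ?F *v \<zeta> s + ?G *v u s) has_integral \<zeta> t - vcat 0 1) {0..t}" if "0 \<le> t" for t
    using traj that by (simp add: trajectory_def)
  have "((\<lambda>s. diag lam *v lower (\<zeta> s)) has_integral lower (\<zeta> t) - 1) {0..t}" if "0 \<le> t" for t
    using has_integral_linear[OF int[OF that] bounded_linear_lower]
    by (simp add: o_def velocity bounded_linear.linear[OF bounded_linear_lower, THEN linear_diff])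
  then have eps: "lower (\<zeta> t) = mexp (t *\<^sub>R diag lam) *v 1" if "0 \<le> t" for t
    using that by (rule diag_mexp_unique)
  have rate: "h (?F *v \<zeta> t + ?G *v u t) = A *v h (\<zeta> t) + B *v u t" if "0 \<le> t" for t
  proof -
    \<comment> \<open>Reshaping \<open>z\<close> to a matrix makes the filter equation and \<open>Z \<theta>\<close> available.\<close>
    obtain Z where Z: "upper (\<zeta> t) = vec_of_mat Z" by (rule vec_of_mat_surj)
    let ?r = "regressor (C *v h (\<zeta> t)) (u t)"
    have "h (?F *v \<zeta> t + ?G *v u t) =
        matrix_inv T *v ((M ** Z + ?r) *v \<theta> + \<Gamma> *v (diag lam *v lower (\<zeta> t)))"
      unfolding velocity h_def[of "vcat _ _"]
      by (simp add: Z vec_of_mat_mult[symmetric] row_kron_vec_of_mat mv.add_right mv.add_left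
          matrix_vector_mul_assoc[symmetric])
    also have "\<Gamma> *v (diag lam *v lower (\<zeta> t)) = M *v (\<Gamma> *v lower (\<zeta> t))"
      using mexp_intertwining[OF decay that] by (simp add: eps[OF that])
    also have "(M ** Z + ?r) *v \<theta> + M *v (\<Gamma> *v lower (\<zeta> t)) = M *v (T *v h (\<zeta> t)) + ?r *v \<theta>"
      by (simp add: h_def Z row_kron_vec_of_mat mv.add_right mv.add_left T_inv
          matrix_vector_mul_assoc[symmetric])
    also have "\<dots> = T *v (A *v h (\<zeta> t) + B *v u t)"
      by (rule plant_identity_of_filter_parametrization[OF param, symmetric])
    finally show ?thesis by (simp add: T_inv)
  qed
  have h0: "h (vcat 0 1) = x0"
  proof -
    have "\<Gamma> *v 1 = T *v x0" using decay[rule_format, of 0] by (simp add: mexp_0)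
    then show ?thesis by (simp add: h_def T_inv matrix_vector_mul_assoc[symmetric])
  qed
  have "((\<lambda>s. A *v h (\<zeta> s) + B *v u s) has_integral h (\<zeta> t) - x0) {0..t}" if "0 \<le> t" for t
  proof -
    have "((\<lambda>s. h (?F *v \<zeta> s + ?G *v u s)) has_integral h (\<zeta> t) - x0) {0..t}"
      using has_integral_linear[OF int[OF that] h]
      by (simp add: o_def linear_diff[OF bounded_linear.linear[OF h]] h0)
    then show ?thesis by (rule has_integral_eq[rotated]) (simp add: rate)
  qed
  then show ?thesis using traj unfolding trajectory_def h_def by blast
qed

theorem proposition1:
  fixes A :: "real^'n^'n" and B :: "real^'m^'n" and C :: "real^'n^'p"
    and Q sqrtQ :: "real^'p^'p" and R :: "real^'m^'m"
    and P :: "real^'n^'n" and K :: "real^'n^'m"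
    and M T \<Gamma> :: "real^'n^'n" and \<theta> :: "real^('p, 'm, 'n) zcol"
    and lam x0 :: "real^'n"
  assumes "controllable A B" and "observable C A"
    and "pos_semidef Q" and "pos_def R"
    and "pos_semidef sqrtQ" and "sqrtQ ** sqrtQ = Q" and "observable (sqrtQ ** C) A"
    and "pos_def P"
    and "transpose A ** P + P ** A - P ** B ** matrix_inv R ** transpose B ** P
           + transpose C ** Q ** C = 0"
    and "K = matrix_inv R ** transpose B ** P"
    and "hurwitz M" and "inj (\<lambda>i. lam $ i)" and "\<forall>i. eigval M (lam $ i)"
    and "invertible T" and "filter_parametrization A B C M T \<theta>"
    and "\<forall>t\<ge>0. mexp (t *\<^sub>R M) *v (T *v x0) = \<Gamma> *v (mexp (t *\<^sub>R diag lam) *v 1)"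
  shows "\<exists>Kz Keps.
    optimal_controller
      (vcat (hcat (A_xi M C \<theta> T) (L_z ** C ** matrix_inv T ** \<Gamma>))
            (hcat 0 (diag lam)))
      (vcat B_xi 0)
      (hcat (C_xi C \<theta> T) (C ** matrix_inv T ** \<Gamma>))
      Q R (vcat 0 1)
      (\<lambda>\<zeta>. - (Kz *v upper \<zeta>) - Keps *v lower \<zeta>) \<and>
    Kz = K ** row_kron \<theta> (matrix_inv T)"
proof (intro exI conjI)
  define Kz where "Kz = K ** row_kron \<theta> (matrix_inv T)"
  define Keps where "Keps = K ** matrix_inv T ** \<Gamma>"
  \<comment> \<open>The plant state as a function of the augmented state.\<close>
  define h where "h v = row_kron \<theta> (matrix_inv T) *v upper v + (matrix_inv T ** \<Gamma>) *v lower v"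
    for v :: "real^((('p, 'm, 'n) zcol \<times> 'n) + 'n)"
  let ?F = "vcat (hcat (A_xi M C \<theta> T) (L_z ** C ** matrix_inv T ** \<Gamma>)) (hcat 0 (diag lam))"
  let ?G = "vcat B_xi 0 :: real^'m^((('p, 'm, 'n) zcol \<times> 'n) + 'n)"
  let ?H = "hcat (C_xi C \<theta> T) (C ** matrix_inv T ** \<Gamma>)"
  have feedback: "- (Kz *v upper v) - Keps *v lower v = - (K *v h v)" for v
    by (simp add: Kz_def Keps_def h_def mv.add_right matrix_vector_mul_assoc[symmetric])
  have cost: "lq_cost ?H Q R u \<zeta> = lq_cost C Q R u (\<lambda>t. h (\<zeta> t))" for u \<zeta>
    by (simp add: lq_cost_def hcat_mult_vector C_xi_def h_def mv.add_right matrix_vector_mul_assoc[symmetric])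
  have plant: "trajectory A B x0 u (\<lambda>t. h (\<zeta> t))" if "trajectory ?F ?G (vcat 0 1) u \<zeta>" for u \<zeta>
    unfolding h_def using augmented_trajectory_yields_plant_trajectory[OF assms(14-16) that] .
  have "linear (\<lambda>v. - (K *v h v))"
    unfolding h_def by (intro bounded_linear.linear bounded_linear_minus bounded_linear_add
        bounded_linear_compose[OF mv.bounded_linear_right]
        bounded_linear_compose[OF mv.bounded_linear_right bounded_linear_upper]
        bounded_linear_compose[OF mv.bounded_linear_right bounded_linear_lower])
  note closed_loop = linear_feedback_trajectory_exists[OF this]
  have upper_bound: "lq_cost ?H Q R (\<lambda>t. - (K *v h (\<zeta> t))) \<zeta> \<le> ennreal (x0 \<bullet> (P *v x0))"
    if "trajectory ?F ?G (vcat 0 1) (\<lambda>t. - (K *v h (\<zeta> t))) \<zeta>" for \<zeta>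
    unfolding cost using plant[OF that] by (rule riccati_feedback_cost_le[OF assms(3,4,8-10)])
  have lower_bound: "ennreal (x0 \<bullet> (P *v x0)) \<le> lq_cost ?H Q R u \<zeta>"
    if "trajectory ?F ?G (vcat 0 1) u \<zeta>" for u \<zeta>
    unfolding cost using plant[OF that] by (rule riccati_cost_ge[OF assms(3,4,8,5-7,9,10)])
  show "optimal_controller ?F ?G ?H Q R (vcat 0 1) (\<lambda>\<zeta>. - (Kz *v upper \<zeta>) - Keps *v lower \<zeta>)"
    unfolding optimal_controller_def feedback
  proof (intro conjI allI impI)
    show "\<exists>x. trajectory ?F ?G (vcat 0 1) (\<lambda>t. - (K *v h (x t))) x" by (rule closed_loop)
  next
    fix \<zeta> assume "trajectory ?F ?G (vcat 0 1) (\<lambda>t. - (K *v h (\<zeta> t))) \<zeta>"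
    from upper_bound[OF this]
    show "lq_cost ?H Q R (\<lambda>t. - (K *v h (\<zeta> t))) \<zeta> < \<infinity>"
      by (rule le_less_trans) simp
  next
    fix \<zeta> u' \<zeta>'
    assume "trajectory ?F ?G (vcat 0 1) (\<lambda>t. - (K *v h (\<zeta> t))) \<zeta>"
      and "trajectory ?F ?G (vcat 0 1) u' \<zeta>'"
    then show "lq_cost ?H Q R (\<lambda>t. - (K *v h (\<zeta> t))) \<zeta> \<le> lq_cost ?H Q R u' \<zeta>'"
      by (rule order_trans[OF upper_bound lower_bound])
  qed
  show "Kz = K ** row_kron \<theta> (matrix_inv T)" by (rule Kz_def)
qed

end
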